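(* Let $\bar p=(p(1),p(2),\dots)$, $0\le p(i)\le 1$. If $\prod_{i=1}^\infty(1-p(i))^i>0$, then for every first order sentence $\psi$ from $L_{\le}$ the probability $\mathrm{Prob}(n,\bar p;\psi)$ converges as $n\to\infty$.
   Context: For a sequence $\bar p=(p(1),p(2),\dots)$ with $0\le p(i)\le 1$, $G(n,\bar p)$ is the random graph with vertex set $[n]=\{1,\dots,n\}$ in which each pair of distinct vertices $v,w$ is an edge with probability $p(|v-w|)$, independently for each pair. $L_{\le}$ is first order logic with equality, a binary adjacency predicate and a binary predicate "$x\le y$". $\mathrm{Prob}(n,\bar p;\psi)$ denotes the probability that the sentence $\psi$ holds in the structure with universe $[n]$ whose adjacency relation is given by $G(n,\bar p)$ and whose predicate $\le$ is the usual order on $[n]$. *)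

theory Defs
  imports "HOL-Probability.Probability"
begin

text \<open>
  Variables are natural numbers. Negation, conjunction and the existential quantifier are taken
  as primitive; the remaining connectives and the universal quantifier are the usual abbreviations.
\<close>

datatype fm =
    Equal nat nat
  | Adj nat nat
  | Leq nat nat
  | Neg fm
  | Conj fm fm
  | Ex nat fm

primrec fv :: "fm \<Rightarrow> nat set" where
  "fv (Equal x y) = {x, y}"
| "fv (Adj x y) = {x, y}"
| "fv (Leq x y) = {x, y}"
| "fv (Neg \<phi>) = fv \<phi>"
| "fv (Conj \<phi> \<psi>) = fv \<phi> \<union> fv \<psi>"
| "fv (Ex x \<phi>) = fv \<phi> - {x}"

definition sentence :: "fm \<Rightarrow> bool" where
  "sentence \<phi> \<longleftrightarrow> fv \<phi> = {}"

primrec sat ::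
  "'a set \<Rightarrow> ('a \<Rightarrow> 'a \<Rightarrow> bool) \<Rightarrow> ('a \<Rightarrow> 'a \<Rightarrow> bool) \<Rightarrow> (nat \<Rightarrow> 'a) \<Rightarrow> fm \<Rightarrow> bool" where
  "sat U A L s (Equal x y) \<longleftrightarrow> s x = s y"
| "sat U A L s (Adj x y) \<longleftrightarrow> A (s x) (s y)"
| "sat U A L s (Leq x y) \<longleftrightarrow> L (s x) (s y)"
| "sat U A L s (Neg \<phi>) \<longleftrightarrow> \<not> sat U A L s \<phi>"
| "sat U A L s (Conj \<phi> \<psi>) \<longleftrightarrow> sat U A L s \<phi> \<and> sat U A L s \<psi>"
| "sat U A L s (Ex x \<phi>) \<longleftrightarrow> (\<exists>a\<in>U. sat U A L (s(x := a)) \<phi>)"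

lemma sat_cong:
  assumes "\<And>x. x \<in> fv \<phi> \<Longrightarrow> s x = t x"
  shows "sat U A L s \<phi> = sat U A L t \<phi>"
  using assms
proof (induction \<phi> arbitrary: s t)
  case (Ex x \<phi>)
  have "sat U A L (s(x := a)) \<phi> = sat U A L (t(x := a)) \<phi>" for a
    by (rule Ex.IH) (use Ex.prems in auto)
  then show ?case by simp
next
  case (Conj \<phi> \<psi>)
  have "sat U A L s \<phi> = sat U A L t \<phi>" "sat U A L s \<psi> = sat U A L t \<psi>"
    by (rule Conj.IH, use Conj.prems in simp)+
  then show ?case by simp
next
  case (Neg \<phi>)
  have "sat U A L s \<phi> = sat U A L t \<phi>"
    by (rule Neg.IH) (use Neg.prems in simp)
  then show ?case by simp
qed simp_all

text \<open>By \<open>sat_cong\<close>, for a sentence the choice of the valuation is immaterial.\<close>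

definition models ::
  "'a set \<Rightarrow> ('a \<Rightarrow> 'a \<Rightarrow> bool) \<Rightarrow> ('a \<Rightarrow> 'a \<Rightarrow> bool) \<Rightarrow> fm \<Rightarrow> bool" where
  "models U A L \<psi> \<longleftrightarrow> (\<forall>s. sat U A L s \<psi>)"

text \<open>
  An unordered pair of distinct vertices is represented by its increasing enumeration
  \<open>(v, w)\<close>, \<open>v < w\<close>, so that \<open>\<bar>v - w\<bar> = w - v\<close>.
\<close>

definition vertex_pairs :: "nat \<Rightarrow> (nat \<times> nat) set" where
  "vertex_pairs n = {(v, w). 1 \<le> v \<and> v < w \<and> w \<le> n}"

text \<open>
  The default value \<open>False\<close> off \<open>vertex_pairs n\<close> makes the symmetrised relation loop-free and
  confined to \<open>{1..n}\<close>.
\<close>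

definition random_graph :: "nat \<Rightarrow> (nat \<Rightarrow> real) \<Rightarrow> (nat \<Rightarrow> nat \<Rightarrow> bool) pmf" where
  "random_graph n p =
     map_pmf (\<lambda>X v w. X (v, w) \<or> X (w, v))
       (Pi_pmf (vertex_pairs n) False (\<lambda>(v, w). bernoulli_pmf (p (w - v))))"

definition Prob :: "nat \<Rightarrow> (nat \<Rightarrow> real) \<Rightarrow> fm \<Rightarrow> real" where
  "Prob n p \<psi> = measure_pmf.prob (random_graph n p) {A. models {1..n} A (\<le>) \<psi>}"

end

theory Submission imports Defs begin

text \<open>
  Positivity of the product says that all \<open>p i\<close> are less than \<open>1\<close> and that \<open>i * p i\<close> is summable.
  At most \<open>i\<close> pairs at distance \<open>i\<close> cross a given place between consecutive vertices, so with
  probability at least \<open>P\<close> it is crossed by no edge at all (\<open>prod_crossing\<close>), and edges longer than \<open>l\<close> cross it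
  with a probability that tends to \<open>0\<close> as \<open>l\<close> grows (\<open>prob_long_edge\<close>, \<open>small_tails\<close>). A random graph is thus
  an ordered sum of finite pieces between cuts.

  Fix the quantifier rank \<open>k\<close> of the sentence and identify ordered graphs that the \<open>k\<close>-round
  Ehrenfeucht-Fraisse game cannot tell apart. The class of an ordered sum depends only on the classes of
  the summands (\<open>eqv_osum\<close>), there are finitely many classes (\<open>eqv_finite_index\<close>), and large powers
  of a graph are equivalent (\<open>eqv_copies\<close>). In such a finite aperiodic monoid there is an absorbing
  element \<open>w\<close>, one with \<open>w x w = w\<close> for all \<open>x\<close> (\<open>exists_absorbing\<close>).

  A representative of \<open>w\<close> can be chosen that occurs between two cuts with positive probability
  (\<open>prob_copy_at\<close>). Among sufficiently many disjoint windows near each end of the graph, one contains such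
  a copy with probability close to \<open>1\<close> (\<open>prob_no_copy\<close>). Then the graph is \<open>x w y w z\<close>, which
  is equivalent to \<open>x w z\<close> (\<open>eqv_outer_parts\<close>): the truth of the sentence is determined by boundedly
  many vertices at the two ends. The joint distribution of the two ends is the same for all large \<open>n\<close>
  (\<open>prob_verdict\<close>), so the probabilities form a Cauchy sequence.
\<close>

section \<open>Back-and-forth equivalence of ordered graphs\<close>

primrec qr :: "fm \<Rightarrow> nat" where
  "qr (Equal x y) = 0"
| "qr (Adj x y) = 0"
| "qr (Leq x y) = 0"
| "qr (Neg \<phi>) = qr \<phi>"
| "qr (Conj \<phi> \<psi>) = max (qr \<phi>) (qr \<psi>)"
| "qr (Ex x \<phi>) = Suc (qr \<phi>)"

text \<open>Preserving \<open>\<le>\<close> in both directions makes \<open>R\<close> injective, which settles equality atoms.\<close>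

definition partial_iso ::
  "(nat \<Rightarrow> nat \<Rightarrow> bool) \<Rightarrow> (nat \<Rightarrow> nat \<Rightarrow> bool) \<Rightarrow> (nat \<times> nat) set \<Rightarrow> bool" where
  "partial_iso A B R \<longleftrightarrow>
     (\<forall>(a, b)\<in>R. \<forall>(c, d)\<in>R. (A a c \<longleftrightarrow> B b d) \<and> (a \<le> c \<longleftrightarrow> b \<le> d))"

text \<open>
  Duplicator survives \<open>k\<close> more rounds of the Ehrenfeucht-Fraisse game from the position \<open>R\<close>, the
  set of pairs pebbled so far. Keeping the position as a relation makes composing games on the
  two halves of an ordered sum a mere union of positions.
\<close>

primrec ef ::
  "nat \<Rightarrow> (nat \<Rightarrow> nat \<Rightarrow> bool) \<Rightarrow> nat set \<Rightarrow> (nat \<Rightarrow> nat \<Rightarrow> bool) \<Rightarrow> nat set \<Rightarrow> (nat \<times> nat) set \<Rightarrow> bool"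
where
  "ef 0 A U B V R \<longleftrightarrow> partial_iso A B R"
| "ef (Suc k) A U B V R \<longleftrightarrow> partial_iso A B R
     \<and> (\<forall>a\<in>U. \<exists>b\<in>V. ef k A U B V (insert (a, b) R))
     \<and> (\<forall>b\<in>V. \<exists>a\<in>U. ef k A U B V (insert (a, b) R))"

lemma ef_partial_iso: "ef k A U B V R \<Longrightarrow> partial_iso A B R"
  by (cases k) auto

lemma partial_iso_subset: "partial_iso A B R \<Longrightarrow> S \<subseteq> R \<Longrightarrow> partial_iso A B S"
  unfolding partial_iso_def by blast

lemma ef_subset: "ef k A U B V R \<Longrightarrow> S \<subseteq> R \<Longrightarrow> ef k A U B V S"
proof (induction k arbitrary: R S)
  case (Suc k)
  have "ef k A U B V (insert x S)" if "ef k A U B V (insert x R)" for x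
    using Suc.IH[OF that] Suc.prems(2) by blast
  moreover have "partial_iso A B S"
    using Suc.prems partial_iso_subset ef_partial_iso by blast
  ultimately show ?case
    using Suc.prems(1) unfolding ef.simps by blast
qed (simp add: partial_iso_subset)

lemma ef_mono: "ef k A U B V R \<Longrightarrow> j \<le> k \<Longrightarrow> ef j A U B V R"
proof (induction j arbitrary: k R)
  case (Suc j)
  then obtain k' where k: "k = Suc k'" "j \<le> k'" by (cases k) auto
  show ?case
    using Suc.prems(1) Suc.IH[OF _ k(2)] unfolding k(1) ef.simps by blast
qed (simp add: ef_partial_iso)

lemma ef_sat:
  assumes "ef k A U B V R" "qr \<phi> \<le> k" "\<And>x. x \<in> fv \<phi> \<Longrightarrow> (s x, t x) \<in> R"
  shows "sat U A (\<le>) s \<phi> \<longleftrightarrow> sat V B (\<le>) t \<phi>"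
  using assms
proof (induction \<phi> arbitrary: k R s t)
  case (Equal x y)
  have "partial_iso A B R" using Equal ef_partial_iso by blast
  moreover have "(s x, t x) \<in> R" "(s y, t y) \<in> R" using Equal by auto
  ultimately have "(s x \<le> s y) = (t x \<le> t y)" "(s y \<le> s x) = (t y \<le> t x)"
    unfolding partial_iso_def by fast+
  then show ?case by (auto simp: eq_iff)
next
  case (Adj x y)
  have "partial_iso A B R" using Adj ef_partial_iso by blast
  moreover have "(s x, t x) \<in> R" "(s y, t y) \<in> R" using Adj by auto
  ultimately show ?case unfolding partial_iso_def by auto
next
  case (Leq x y)
  have "partial_iso A B R" using Leq ef_partial_iso by blast
  moreover have "(s x, t x) \<in> R" "(s y, t y) \<in> R" using Leq by auto
  ultimately show ?case unfolding partial_iso_def by auto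
next
  case (Neg \<phi>)
  have "sat U A (\<le>) s \<phi> \<longleftrightarrow> sat V B (\<le>) t \<phi>"
    by (rule Neg.IH[OF Neg.prems(1)]) (use Neg.prems in auto)
  then show ?case by simp
next
  case (Conj \<phi> \<psi>)
  have "sat U A (\<le>) s \<phi> \<longleftrightarrow> sat V B (\<le>) t \<phi>"
    by (rule Conj.IH(1)[OF Conj.prems(1)]) (use Conj.prems in auto)
  moreover have "sat U A (\<le>) s \<psi> \<longleftrightarrow> sat V B (\<le>) t \<psi>"
    by (rule Conj.IH(2)[OF Conj.prems(1)]) (use Conj.prems in auto)
  ultimately show ?case by simp
next
  case (Ex x \<phi>)
  then obtain k' where k: "k = Suc k'" "qr \<phi> \<le> k'" by (cases k) auto
  have step: "sat U A (\<le>) (s(x := a)) \<phi> \<longleftrightarrow> sat V B (\<le>) (t(x := b)) \<phi>"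
    if "ef k' A U B V (insert (a, b) R)" for a b
    by (rule Ex.IH[OF that k(2)]) (use Ex.prems(3) in auto)
  show ?case
    using Ex.prems(1) step unfolding k(1) ef.simps sat.simps by blast
qed

lemma ef_sym: "ef k A U B V R \<Longrightarrow> ef k B V A U (R\<inverse>)"
proof (induction k arbitrary: R)
  case 0
  then show ?case unfolding ef.simps partial_iso_def by blast
next
  case (Suc k)
  have "partial_iso B A (R\<inverse>)" using Suc.prems unfolding ef.simps partial_iso_def by blast
  moreover have "ef k B V A U (insert (b, a) (R\<inverse>))" if "ef k A U B V (insert (a, b) R)" for a b
  proof -
    have "insert (b, a) (R\<inverse>) = (insert (a, b) R)\<inverse>" by auto
    then show ?thesis using Suc.IH[OF that] by simp
  qed
  ultimately show ?case using Suc.prems unfolding ef.simps by blast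
qed

lemma partial_iso_trans: "partial_iso A B R \<Longrightarrow> partial_iso B C S \<Longrightarrow> partial_iso A C (R O S)"
  unfolding partial_iso_def by fast

lemma ef_trans: "ef k A U B V R \<Longrightarrow> ef k B V C W S \<Longrightarrow> ef k A U C W (R O S)"
proof (induction k arbitrary: R S)
  case 0
  then show ?case by (simp add: partial_iso_trans)
next
  case (Suc k)
  have "partial_iso A C (R O S)" using Suc.prems ef_partial_iso partial_iso_trans by blast
  moreover have "ef k A U C W (insert (a, c) (R O S))"
    if "ef k A U B V (insert (a, b) R)" "ef k B V C W (insert (b, c) S)" for a b c
    using Suc.IH[OF that] by (rule ef_subset) auto
  ultimately show ?case using Suc.prems unfolding ef.simps by blast
qed

lemma ef_refl: "R \<subseteq> Id \<Longrightarrow> ef k A U A U R"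
proof (induction k arbitrary: R)
  case 0
  then show ?case by (auto simp: partial_iso_def)
next
  case (Suc k)
  have "partial_iso A A R" using Suc.prems by (auto simp: partial_iso_def)
  moreover have "ef k A U A U (insert (a, a) R)" for a using Suc by simp
  ultimately show ?case unfolding ef.simps by blast
qed

text \<open>This carries a game on a summand over to the place that the summand takes in an ordered sum.\<close>

lemma ef_embed:
  assumes "ef k A U B V R" "R \<subseteq> U \<times> V"
    and "\<And>a c. a \<in> U \<Longrightarrow> c \<in> U \<Longrightarrow> (A a c \<longleftrightarrow> A' (f a) (f c)) \<and> (a \<le> c \<longleftrightarrow> f a \<le> f c)"
    and "\<And>b d. b \<in> V \<Longrightarrow> d \<in> V \<Longrightarrow> (B b d \<longleftrightarrow> B' (g b) (g d)) \<and> (b \<le> d \<longleftrightarrow> g b \<le> g d)"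
  shows "ef k A' (f ` U) B' (g ` V) (map_prod f g ` R)"
  using assms(1,2)
proof (induction k arbitrary: R)
  have piso: "partial_iso A' B' (map_prod f g ` R)" if R: "partial_iso A B R" "R \<subseteq> U \<times> V" for R
  proof -
    have "(A' (f a) (f c) \<longleftrightarrow> B' (g b) (g d)) \<and> (f a \<le> f c \<longleftrightarrow> g b \<le> g d)"
      if "(a, b) \<in> R" "(c, d) \<in> R" for a b c d
    proof -
      have "a \<in> U" "c \<in> U" "b \<in> V" "d \<in> V" using that R(2) by auto
      moreover have "(A a c \<longleftrightarrow> B b d) \<and> (a \<le> c \<longleftrightarrow> b \<le> d)"
        using that R(1) unfolding partial_iso_def by blast
      ultimately show ?thesis using assms(3)[of a c] assms(4)[of b d] by simp
    qed
    then show ?thesis unfolding partial_iso_def by auto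
  qed
  {
    case 0
    then show ?case using piso by simp
  next
    case (Suc k)
    have "partial_iso A' B' (map_prod f g ` R)" using Suc.prems piso by simp
    moreover have "ef k A' (f ` U) B' (g ` V) (insert (f a, g b) (map_prod f g ` R))"
      if "ef k A U B V (insert (a, b) R)" "a \<in> U" "b \<in> V" for a b
      using Suc.IH[OF that(1)] that(2,3) Suc.prems(2) by simp
    ultimately show ?case using Suc.prems(1) unfolding ef.simps by blast
  }
qed

text \<open>
  On an ordered sum without edges between the two parts, Duplicator answers in the part in which
  Spoiler plays: atomic relations between different parts carry no information.
\<close>

lemma ef_union:
  assumes "ef k A U1 B V1 R1" "ef k A U2 B V2 R2" "R1 \<subseteq> U1 \<times> V1" "R2 \<subseteq> U2 \<times> V2"
    and U: "\<And>a c. a \<in> U1 \<Longrightarrow> c \<in> U2 \<Longrightarrow> a < c \<and> \<not> A a c \<and> \<not> A c a"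
    and V: "\<And>b d. b \<in> V1 \<Longrightarrow> d \<in> V2 \<Longrightarrow> b < d \<and> \<not> B b d \<and> \<not> B d b"
  shows "ef k A (U1 \<union> U2) B (V1 \<union> V2) (R1 \<union> R2)"
  using assms(1-4)
proof (induction k arbitrary: R1 R2)
  have piso: "partial_iso A B (R1 \<union> R2)"
    if R: "partial_iso A B R1" "partial_iso A B R2" "R1 \<subseteq> U1 \<times> V1" "R2 \<subseteq> U2 \<times> V2" for R1 R2
  proof -
    have "(A a c \<longleftrightarrow> B b d) \<and> (a \<le> c \<longleftrightarrow> b \<le> d)"
      if "(a, b) \<in> R1 \<union> R2" "(c, d) \<in> R1 \<union> R2" for a b c d
      using that
    proof (elim UnE)
      assume "(a, b) \<in> R1" "(c, d) \<in> R2"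
      then have "a \<in> U1" "c \<in> U2" "b \<in> V1" "d \<in> V2" using R(3,4) by auto
      then show ?thesis using U[of a c] V[of b d] by simp
    next
      assume "(a, b) \<in> R2" "(c, d) \<in> R1"
      then have "a \<in> U2" "c \<in> U1" "b \<in> V2" "d \<in> V1" using R(3,4) by auto
      then show ?thesis using U[of c a] V[of d b] by simp
    qed (use R(1,2) in \<open>auto simp: partial_iso_def\<close>)
    then show ?thesis unfolding partial_iso_def by blast
  qed
  {
    case 0
    then show ?case using piso by simp
  next
    case (Suc k)
    have left: "ef k A (U1 \<union> U2) B (V1 \<union> V2) (insert (a, b) (R1 \<union> R2))"
      if "ef k A U1 B V1 (insert (a, b) R1)" "a \<in> U1" "b \<in> V1" for a b
      using Suc.IH[OF that(1) ef_mono[OF Suc.prems(2)]] that(2,3) Suc.prems(3,4) by simp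
    have right: "ef k A (U1 \<union> U2) B (V1 \<union> V2) (insert (a, b) (R1 \<union> R2))"
      if "ef k A U2 B V2 (insert (a, b) R2)" "a \<in> U2" "b \<in> V2" for a b
      using Suc.IH[OF ef_mono[OF Suc.prems(1)] that(1)] that(2,3) Suc.prems(3,4) by simp
    have "partial_iso A B (R1 \<union> R2)" using Suc.prems piso by simp
    moreover have "\<forall>a\<in>U1 \<union> U2. \<exists>b\<in>V1 \<union> V2. ef k A (U1 \<union> U2) B (V1 \<union> V2) (insert (a, b) (R1 \<union> R2))"
    proof
      fix a assume "a \<in> U1 \<union> U2"
      moreover have "\<exists>b\<in>V1. ef k A U1 B V1 (insert (a, b) R1)" if "a \<in> U1"
        using Suc.prems(1) that by simp
      moreover have "\<exists>b\<in>V2. ef k A U2 B V2 (insert (a, b) R2)" if "a \<in> U2"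
        using Suc.prems(2) that by simp
      ultimately show "\<exists>b\<in>V1 \<union> V2. ef k A (U1 \<union> U2) B (V1 \<union> V2) (insert (a, b) (R1 \<union> R2))"
        using left right by (metis UnE UnI1 UnI2)
    qed
    moreover have "\<forall>b\<in>V1 \<union> V2. \<exists>a\<in>U1 \<union> U2. ef k A (U1 \<union> U2) B (V1 \<union> V2) (insert (a, b) (R1 \<union> R2))"
    proof
      fix b assume "b \<in> V1 \<union> V2"
      moreover have "\<exists>a\<in>U1. ef k A U1 B V1 (insert (a, b) R1)" if "b \<in> V1"
        using Suc.prems(1) that by simp
      moreover have "\<exists>a\<in>U2. ef k A U2 B V2 (insert (a, b) R2)" if "b \<in> V2"
        using Suc.prems(2) that by simp
      ultimately show "\<exists>a\<in>U1 \<union> U2. ef k A (U1 \<union> U2) B (V1 \<union> V2) (insert (a, b) (R1 \<union> R2))"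
        using left right by (metis UnE UnI1 UnI2)
    qed
    ultimately show ?case unfolding ef.simps by (intro conjI) 
  }
qed

section \<open>The monoid of ordered graphs\<close>

text \<open>
  A graph of size \<open>n\<close> lives on \<open>{..<n}\<close>. Counting from \<open>0\<close> makes the empty graph a literal left
  unit and the ordered sum literally associative, so that powers can be split by rewriting.
\<close>

type_synonym ograph = "nat \<times> (nat \<Rightarrow> nat \<Rightarrow> bool)"

definition game :: "nat \<Rightarrow> ograph \<Rightarrow> ograph \<Rightarrow> (nat \<times> nat) set \<Rightarrow> bool" where
  "game k x y R \<longleftrightarrow> ef k (snd x) {..<fst x} (snd y) {..<fst y} R"

abbreviation eqv :: "nat \<Rightarrow> ograph \<Rightarrow> ograph \<Rightarrow> bool" where
  "eqv k x y \<equiv> game k x y {}"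

definition osum :: "ograph \<Rightarrow> ograph \<Rightarrow> ograph" (infixr \<open>\<oplus>\<close> 65) where
  "x \<oplus> y = (fst x + fst y, \<lambda>i j. i < fst x \<and> j < fst x \<and> snd x i j
     \<or> fst x \<le> i \<and> fst x \<le> j \<and> snd y (i - fst x) (j - fst x))"

definition oempty :: ograph where
  "oempty = (0, \<lambda>_ _. False)"

lemma osum_assoc: "(x \<oplus> y) \<oplus> z = x \<oplus> (y \<oplus> z)"
proof -
  have parts: "i < m \<or> (\<exists>i'<n. i = m + i') \<or> (\<exists>i'. i = m + n + i')" for i m n :: nat
    by presburger
  obtain a A b B c C where xyz: "x = (a, A)" "y = (b, B)" "z = (c, C)" by (metis prod.exhaust)
  have "snd ((x \<oplus> y) \<oplus> z) i j = snd (x \<oplus> (y \<oplus> z)) i j" for i j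
    using parts[of i a b] parts[of j a b] by (elim disjE exE conjE) (simp_all add: osum_def xyz)
  then show ?thesis by (simp add: prod_eq_iff fun_eq_iff osum_def)
qed

lemma oempty_osum: "oempty \<oplus> x = x"
  unfolding osum_def oempty_def by (simp add: prod_eq_iff)

lemma fst_osum [simp]: "fst (x \<oplus> y) = fst x + fst y"
  by (simp add: osum_def)

lemma eqv_refl: "eqv k x x"
  by (simp add: game_def ef_refl)

lemma game_sym: "game k x y R \<Longrightarrow> game k y x (R\<inverse>)"
  unfolding game_def by (rule ef_sym)

lemma eqv_sym: "eqv k x y \<Longrightarrow> eqv k y x"
  by (drule game_sym) simp

lemma eqv_trans [trans]: "eqv k x y \<Longrightarrow> eqv k y z \<Longrightarrow> eqv k x z"
  unfolding game_def by (drule (1) ef_trans) simp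

lemma eqvI_on_universe:
  assumes "fst x = fst y" "\<And>i j. i < fst x \<Longrightarrow> j < fst x \<Longrightarrow> snd x i j = snd y i j"
  shows "eqv k x y"
proof -
  have "ef k (snd x) ((\<lambda>i. i) ` {..<fst x}) (snd y) ((\<lambda>i. i) ` {..<fst x})
      (map_prod (\<lambda>i. i) (\<lambda>i. i) ` {})"
    by (rule ef_embed[where A = "snd x" and B = "snd x"]) (use assms in \<open>auto simp: ef_refl\<close>)
  then show ?thesis by (simp add: game_def assms(1))
qed

lemma game_osum:
  assumes "game k x x' R" "game k y y' S"
    and R: "R \<subseteq> {..<fst x} \<times> {..<fst x'}" and S: "S \<subseteq> {..<fst y} \<times> {..<fst y'}"
  shows "game k (x \<oplus> y) (x' \<oplus> y') (R \<union> map_prod ((+) (fst x)) ((+) (fst x')) ` S)"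
proof -
  let ?f = "(+) (fst x)" and ?g = "(+) (fst x')"
  have 1: "ef k (snd (x \<oplus> y)) ((\<lambda>i. i) ` {..<fst x}) (snd (x' \<oplus> y')) ((\<lambda>i. i) ` {..<fst x'})
      (map_prod (\<lambda>i. i) (\<lambda>i. i) ` R)"
    by (rule ef_embed[OF assms(1)[unfolded game_def] R]) (auto simp: osum_def)
  have 2: "ef k (snd (x \<oplus> y)) (?f ` {..<fst y}) (snd (x' \<oplus> y')) (?g ` {..<fst y'})
      (map_prod ?f ?g ` S)"
    by (rule ef_embed[OF assms(2)[unfolded game_def] S]) (auto simp: osum_def)
  have image: "{..<m} \<union> (+) m ` {..<n} = {..<m + n}" for m n :: nat
  proof -
    have "(+) m ` {..<n} = {m..<m + n}"
      using image_add_atLeastLessThan[of m 0 n] by (simp add: lessThan_atLeast0 add.commute)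
    then show ?thesis by auto
  qed
  have "ef k (snd (x \<oplus> y)) ({..<fst x} \<union> ?f ` {..<fst y})
      (snd (x' \<oplus> y')) ({..<fst x'} \<union> ?g ` {..<fst y'}) (R \<union> map_prod ?f ?g ` S)"
  proof (rule ef_union)
    show "ef k (snd (x \<oplus> y)) {..<fst x} (snd (x' \<oplus> y')) {..<fst x'} R"
      using 1 by (simp add: map_prod.identity)
    show "map_prod ?f ?g ` S \<subseteq> ?f ` {..<fst y} \<times> ?g ` {..<fst y'}" using S by auto
  qed (use 2 R in \<open>auto simp: osum_def\<close>)
  then show ?thesis unfolding game_def image by simp
qed

lemma eqv_osum: "eqv k x x' \<Longrightarrow> eqv k y y' \<Longrightarrow> eqv k (x \<oplus> y) (x' \<oplus> y')"
  using game_osum[of k x x' "{}" y y' "{}"] by simp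

subsection \<open>Finitely many classes\<close>

definition index_pairs :: "nat \<Rightarrow> (nat \<Rightarrow> nat \<Rightarrow> bool) \<Rightarrow> nat set" where
  "index_pairs n Q = {prod_encode (i, j) |i j. i < n \<and> j < n \<and> Q i j}"

lemma index_pairs_eqD:
  assumes "index_pairs n Q = index_pairs n Q'" "i < n" "j < n"
  shows "Q i j \<longleftrightarrow> Q' i j"
proof -
  have "prod_encode (i, j) \<in> index_pairs n Q \<longleftrightarrow> Q i j" for Q
    using assms(2,3) by (auto simp: index_pairs_def)
  then show ?thesis using assms(1) by metis
qed

lemma index_pairs_subset: "index_pairs n Q \<subseteq> prod_encode ` ({..<n} \<times> {..<n})"
  by (auto simp: index_pairs_def)

lemma finite_index_pairs: "finite (index_pairs n Q)"
  by (rule finite_subset[OF index_pairs_subset]) simp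

definition pattern :: "ograph \<Rightarrow> nat list \<Rightarrow> nat" where
  "pattern x as = prod_encode
     (set_encode (index_pairs (length as) (\<lambda>i j. snd x (as ! i) (as ! j))),
      set_encode (index_pairs (length as) (\<lambda>i j. as ! i \<le> as ! j)))"

text \<open>
  A numerical code of the \<open>k\<close>-round type of a tuple, whose only purposes are that it
  takes finitely many values and determines \<open>ef k\<close>.
\<close>

primrec code :: "nat \<Rightarrow> ograph \<Rightarrow> nat list \<Rightarrow> nat" where
  "code 0 x as = pattern x as"
| "code (Suc k) x as = prod_encode (pattern x as, set_encode ((\<lambda>a. code k x (as @ [a])) ` {..<fst x}))"

lemma finite_pattern: "finite {pattern x as |x as. length as = r}"
proof (rule finite_subset)
  let ?D = "set_encode ` Pow (prod_encode ` ({..<r} \<times> {..<r}))"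
  show "{pattern x as |x as. length as = r} \<subseteq> prod_encode ` (?D \<times> ?D)"
    using index_pairs_subset[of r] by (auto simp: pattern_def intro!: imageI)
qed simp

lemma finite_code: "finite {code k x as |x as. length as = r}"
proof (induction k arbitrary: r)
  case 0
  show ?case unfolding code.simps by (rule finite_pattern)
next
  case (Suc k)
  let ?C = "{pattern x as |x as. length as = r}"
  let ?D = "{code k x as |x as. length as = Suc r}"
  have "code (Suc k) x as \<in> prod_encode ` (?C \<times> set_encode ` Pow ?D)" if "length as = r" for x as
  proof -
    have "(\<lambda>a. code k x (as @ [a])) ` {..<fst x} \<subseteq> ?D"
    proof clarify
      fix a
      have "length (as @ [a]) = Suc r" using that by simp
      then show "\<exists>y bs. code k x (as @ [a]) = code k y bs \<and> length bs = Suc r" by blast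
    qed
    moreover have "pattern x as \<in> ?C" using that by blast
    ultimately show ?thesis unfolding code.simps by (intro imageI SigmaI PowI)
  qed
  then have "{code (Suc k) x as |x as. length as = r} \<subseteq> prod_encode ` (?C \<times> set_encode ` Pow ?D)"
    by blast
  then show ?case
    by (rule finite_subset) (use Suc finite_pattern in auto)
qed

lemma pattern_partial_iso:
  assumes "pattern x as = pattern y bs" "length as = length bs"
  shows "partial_iso (snd x) (snd y) (set (zip as bs))"
proof -
  have "(snd x (as ! i) (as ! j) \<longleftrightarrow> snd y (bs ! i) (bs ! j)) \<and> (as ! i \<le> as ! j \<longleftrightarrow> bs ! i \<le> bs ! j)"
    if "i < length as" "j < length as" for i j
  proof
    have "index_pairs (length as) (\<lambda>i j. snd x (as ! i) (as ! j))
        = index_pairs (length as) (\<lambda>i j. snd y (bs ! i) (bs ! j))"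
      using assms by (simp add: pattern_def set_encode_eq finite_index_pairs)
    from index_pairs_eqD[OF this that] show "snd x (as ! i) (as ! j) \<longleftrightarrow> snd y (bs ! i) (bs ! j)" .
    have "index_pairs (length as) (\<lambda>i j. as ! i \<le> as ! j) = index_pairs (length as) (\<lambda>i j. bs ! i \<le> bs ! j)"
      using assms by (simp add: pattern_def set_encode_eq finite_index_pairs)
    from index_pairs_eqD[OF this that] show "as ! i \<le> as ! j \<longleftrightarrow> bs ! i \<le> bs ! j" .
  qed
  then show ?thesis
    using assms(2) unfolding partial_iso_def by (auto simp: in_set_zip)
qed

lemma code_ef:
  assumes "code k x as = code k y bs" "length as = length bs"
  shows "ef k (snd x) {..<fst x} (snd y) {..<fst y} (set (zip as bs))"
  using assms
proof (induction k arbitrary: as bs)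
  case 0
  then show ?case by (simp add: pattern_partial_iso)
next
  case (Suc k)
  have eq: "(\<lambda>a. code k x (as @ [a])) ` {..<fst x} = (\<lambda>b. code k y (bs @ [b])) ` {..<fst y}"
    using Suc.prems(1) by (simp add: set_encode_eq)
  have "partial_iso (snd x) (snd y) (set (zip as bs))"
    using Suc.prems by (intro pattern_partial_iso) simp_all
  moreover have "ef k (snd x) {..<fst x} (snd y) {..<fst y} (insert (a, b) (set (zip as bs)))"
    if "code k x (as @ [a]) = code k y (bs @ [b])" for a b
    using Suc.IH[OF that] Suc.prems(2) by simp
  moreover have "\<exists>b\<in>{..<fst y}. code k x (as @ [a]) = code k y (bs @ [b])" if "a \<in> {..<fst x}" for a
    using eq that by blast
  moreover have "\<exists>a\<in>{..<fst x}. code k x (as @ [a]) = code k y (bs @ [b])" if "b \<in> {..<fst y}" for b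
  proof -
    have "code k y (bs @ [b]) \<in> (\<lambda>a. code k x (as @ [a])) ` {..<fst x}" using eq that by blast
    then show ?thesis by auto
  qed
  ultimately show ?case unfolding ef.simps by meson
qed

lemma eqv_finite_index: "finite (range (\<lambda>x. {y. eqv k x y}))"
proof -
  let ?cls = "\<lambda>x. {y. eqv k x y}"
  have cls: "?cls x = ?cls y" if "code k x [] = code k y []" for x y
  proof -
    have "eqv k x y" using code_ef[OF that] by (simp add: game_def)
    then show ?thesis using eqv_sym eqv_trans by blast
  qed
  have "range ?cls \<subseteq> (\<lambda>c. ?cls (SOME x. code k x [] = c)) ` {code k x as |x as. length as = 0}"
  proof safe
    fix x
    have "code k (SOME y. code k y [] = code k x []) [] = code k x []"
      by (rule someI) simp
    note some = this
    show "?cls x \<in> (\<lambda>c. ?cls (SOME x. code k x [] = c)) ` {code k x as |x as. length as = 0}"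
    proof (rule image_eqI)
      show "code k x [] \<in> {code k x as |x as. length as = 0}" by blast
    qed (rule cls, simp add: some)
  qed
  then show ?thesis by (rule finite_subset) (use finite_code in blast)
qed

subsection \<open>Aperiodicity\<close>

text \<open>One round of the game costs half of the copies, and the copy in which it is played.\<close>

primrec threshold :: "nat \<Rightarrow> nat" where
  "threshold 0 = 0"
| "threshold (Suc k) = 2 * threshold k + 1"

abbreviation copies :: "ograph \<Rightarrow> nat \<Rightarrow> ograph" where
  "copies u n \<equiv> ((\<lambda>z. u \<oplus> z) ^^ n) oempty"

lemma copies_osum: "((\<lambda>z. u \<oplus> z) ^^ n) z = copies u n \<oplus> z"
  by (induction n) (simp_all add: oempty_osum osum_assoc)

lemma copies_split: "copies u (i + (1 + j)) = copies u i \<oplus> (u \<oplus> copies u j)"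
proof -
  have "copies u (i + (1 + j)) = ((\<lambda>z. u \<oplus> z) ^^ i) (copies u (1 + j))"
    by (simp only: funpow_add o_apply)
  also have "\<dots> = copies u i \<oplus> copies u (1 + j)" by (rule copies_osum)
  finally show ?thesis by simp
qed

lemma fst_copies: "fst (copies u n) = n * fst u"
  by (induction n) (simp_all add: oempty_def)

text \<open>
  When Spoiler plays in the \<open>i\<close>-th of \<open>m\<close> copies, Duplicator chooses a copy \<open>j\<close> out of \<open>n\<close>
  such that the numbers of copies before and after it agree or are both large, and answers in
  this copy with the same vertex.
\<close>

lemma eqv_copies:
  assumes "m = n \<or> threshold k \<le> m \<and> threshold k \<le> n"
  shows "eqv k (copies u m) (copies u n)"
  using assms
proof (induction k arbitrary: m n)
  case 0
  then show ?case by (simp add: game_def partial_iso_def)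
next
  case (Suc k)
  have forth: "\<exists>b\<in>{..<fst (copies u n)}. game k (copies u m) (copies u n) {(a, b)}"
    if a: "a \<in> {..<fst (copies u m)}" and mn: "threshold (Suc k) \<le> m" "threshold (Suc k) \<le> n"
    for a m n
  proof -
    define i where "i = a div fst u"
    define r where "r = a mod fst u"
    have "fst u > 0" using a by (cases "fst u") (auto simp: fst_copies)
    then have r: "r < fst u" and i: "i < m" and ar: "a = i * fst u + r"
      using a unfolding i_def r_def by (simp_all add: fst_copies less_mult_imp_div_less)
    define j where "j = (if i < threshold k then i
      else if m - 1 - i < threshold k then n - 1 - (m - 1 - i) else threshold k)"
    have j: "j < n" "i = j \<or> threshold k \<le> i \<and> threshold k \<le> j"
      "m - 1 - i = n - 1 - j \<and> i \<ge> threshold k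
         \<or> threshold k \<le> m - 1 - i \<and> threshold k \<le> n - 1 - j"
      using i mn unfolding j_def by auto
    let ?m = "m - 1 - i" and ?n = "n - 1 - j"
    have L: "eqv k (copies u i) (copies u j)" by (rule Suc.IH) (use j(2) in auto)
    have R: "eqv k (copies u ?m) (copies u ?n)" by (rule Suc.IH) (use j(3) in auto)
    have "game k u u {(r, r)}" by (simp add: game_def ef_refl)
    then have "game k (u \<oplus> copies u ?m) (u \<oplus> copies u ?n) {(r, r)}"
      using game_osum[OF _ R, of u u "{(r, r)}"] r by simp
    then have "game k (copies u i \<oplus> (u \<oplus> copies u ?m)) (copies u j \<oplus> (u \<oplus> copies u ?n))
        {(i * fst u + r, j * fst u + r)}"
      using game_osum[OF L, of "u \<oplus> copies u ?m" "u \<oplus> copies u ?n" "{(r, r)}"] r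
      by (simp add: fst_copies)
    moreover have "i + (1 + ?m) = m" "j + (1 + ?n) = n" using i j(1) by auto
    ultimately have "game k (copies u m) (copies u n) {(a, j * fst u + r)}"
      using copies_split[of i ?m u] copies_split[of j ?n u] ar by simp
    moreover have "j * fst u + r < fst (copies u n)"
    proof -
      have "j * fst u + r < Suc j * fst u" using r by simp
      also have "\<dots> \<le> n * fst u" using j(1) by (intro mult_right_mono) auto
      finally show ?thesis by (simp add: fst_copies)
    qed
    ultimately show ?thesis by blast
  qed
  show ?case
  proof (cases "m = n")
    case True
    then show ?thesis by (simp add: eqv_refl)
  next
    case False
    then have mn: "threshold (Suc k) \<le> m" "threshold (Suc k) \<le> n" using Suc.prems by auto
    have converse: "\<exists>a\<in>{..<fst (copies u m)}. game k (copies u m) (copies u n) {(a, b)}"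
      if b: "b \<in> {..<fst (copies u n)}" for b
    proof -
      obtain a where "a \<in> {..<fst (copies u m)}" "game k (copies u n) (copies u m) {(b, a)}"
        using forth[OF b mn(2,1)] by blast
      moreover have "{(b, a)}\<inverse> = {(a, b)}" by auto
      ultimately have "a \<in> {..<fst (copies u m)}" "game k (copies u m) (copies u n) {(a, b)}"
        using game_sym by metis+
      then show ?thesis by blast
    qed
    have "partial_iso (snd (copies u m)) (snd (copies u n)) {}" by (simp add: partial_iso_def)
    then show ?thesis
      using forth[OF _ mn] converse by (simp add: game_def)
  qed
qed

subsection \<open>Absorbing graphs\<close>

text \<open>
  In a finite aperiodic semigroup some \<open>w\<close> satisfies \<open>w x w = w\<close> for all \<open>x\<close>. Choosing \<open>a\<close> with
  the right ideal \<open>a X\<close> as small as possible and \<open>w = a a\<close>, the ideal \<open>w x w X\<close> is all of \<open>a X\<close>,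
  whence \<open>(w x) w y = w\<close> for some \<open>y\<close>; iterating, \<open>w = (w x)\<^sup>N w y\<^sup>N\<close>, and by aperiodicity a
  further factor \<open>w x\<close> on the left changes nothing. The semigroup is presented through
  representatives \<open>X\<close> and an equivalence \<open>E\<close>.
\<close>

lemma exists_absorbing:
  fixes f :: "'a \<Rightarrow> 'a \<Rightarrow> 'a" and E :: "'a \<Rightarrow> 'a \<Rightarrow> bool"
  assumes assoc: "\<And>x y z. f (f x y) z = f x (f y z)"
    and refl: "\<And>x. E x x" and sym: "\<And>x y. E x y \<Longrightarrow> E y x"
    and trans: "\<And>x y z. E x y \<Longrightarrow> E y z \<Longrightarrow> E x z"
    and cong: "\<And>x x' y y'. E x x' \<Longrightarrow> E y y' \<Longrightarrow> E (f x y) (f x' y')"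
    and fin: "finite (range (\<lambda>x. {y. E x y}))"
    and aper: "\<And>u z. E ((f u ^^ Suc N) z) ((f u ^^ N) z)"
    and X: "x0 \<in> X" "\<And>x y. x \<in> X \<Longrightarrow> y \<in> X \<Longrightarrow> f x y \<in> X"
  shows "\<exists>w\<in>X. \<forall>x\<in>X. E (f w (f x w)) w"
proof -
  define ideal where "ideal a = (\<lambda>x. {y. E (f a x) y}) ` X" for a
  have fin_ideal: "finite (ideal a)" for a
    by (rule finite_subset[OF _ fin]) (auto simp: ideal_def)
  obtain a where a: "a \<in> X" "\<And>b. b \<in> X \<Longrightarrow> card (ideal a) \<le> card (ideal b)"
    using ex_has_least_nat[of "\<lambda>a. a \<in> X" x0 "\<lambda>a. card (ideal a)"] X(1) by blast
  have minimal: "\<exists>y\<in>X. E (f (f a u) y) (f a z)" if "u \<in> X" "z \<in> X" for u z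
  proof -
    have "ideal (f a u) \<subseteq> ideal a" using X(2) that(1) by (auto simp: ideal_def assoc)
    moreover have "card (ideal a) \<le> card (ideal (f a u))" using a X(2) that(1) by blast
    ultimately have "ideal (f a u) = ideal a" using fin_ideal by (metis card_seteq)
    then have "{y. E (f a z) y} \<in> ideal (f a u)" using that(2) by (auto simp: ideal_def)
    then show ?thesis unfolding ideal_def using refl by blast
  qed
  define w where "w = f a a"
  have "w \<in> X" using a X by (simp add: w_def)
  moreover have "E (f w (f x w)) w" if x: "x \<in> X" for x
  proof -
    \<comment> \<open>left multiplication by \<open>w x\<close>; \<open>y\<close> below undoes it on \<open>w\<close> from the right\<close>
    define l where "l = f (f w x)"
    have l_assoc: "(l ^^ n) (f z y) = f ((l ^^ n) z) y" for n z y
      by (induction n) (simp_all add: l_def assoc)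
    have l_cong: "E (l z) (l z')" if "E z z'" for z z' using that cong refl by (simp add: l_def)
    have "f (f a x) w \<in> X" using a x \<open>w \<in> X\<close> X(2) by blast
    then obtain y where "E (f (f a (f (f a x) w)) y) w" using minimal[of _ a] a(1) unfolding w_def by blast
    then have y: "E (f (l w) y) w" by (simp add: l_def w_def assoc)
    have iter: "E ((l ^^ n) (((\<lambda>z. f z y) ^^ n) w)) w" for n
    proof (induction n)
      case (Suc n)
      have "(l ^^ Suc n) (((\<lambda>z. f z y) ^^ Suc n) w) = f (l ((l ^^ n) (((\<lambda>z. f z y) ^^ n) w))) y"
        using l_assoc[of "Suc n"] by simp
      then show ?case using cong[OF l_cong[OF Suc] refl] y trans by metis
    qed (simp add: refl)
    have "E (l w) (l ((l ^^ N) (((\<lambda>z. f z y) ^^ N) w)))"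
      by (rule l_cong) (rule sym[OF iter])
    moreover have "E (l ((l ^^ N) (((\<lambda>z. f z y) ^^ N) w))) ((l ^^ N) (((\<lambda>z. f z y) ^^ N) w))"
      using aper[of "f w x"] by (simp add: l_def)
    ultimately have "E (l w) w" using iter trans by blast
    then show ?thesis by (simp add: l_def assoc)
  qed
  ultimately show ?thesis by blast
qed

lemma exists_absorbing_ograph:
  assumes "x0 \<in> X" "\<And>x y. x \<in> X \<Longrightarrow> y \<in> X \<Longrightarrow> x \<oplus> y \<in> X"
  shows "\<exists>w\<in>X. \<forall>x\<in>X. eqv k (w \<oplus> (x \<oplus> w)) w"
proof (rule exists_absorbing[where N = "threshold k"])
  fix u z
  have "eqv k (copies u (Suc (threshold k))) (copies u (threshold k))"
    by (rule eqv_copies) simp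
  then have "eqv k (copies u (Suc (threshold k)) \<oplus> z) (copies u (threshold k) \<oplus> z)"
    by (rule eqv_osum) (rule eqv_refl)
  then show "eqv k (((\<oplus>) u ^^ Suc (threshold k)) z) (((\<oplus>) u ^^ threshold k) z)"
    by (simp only: copies_osum [symmetric])
qed (use assms eqv_finite_index in \<open>auto simp: osum_assoc eqv_refl eqv_sym intro: eqv_trans eqv_osum\<close>)

section \<open>Segments and cuts\<close>

text \<open>
  A configuration \<open>X\<close> is read only at increasing pairs. The segment of the vertices
  \<open>u + 1, ..., v\<close> is moved to \<open>{..<v - u}\<close>; truncating its adjacency relation makes the
  equations below hold literally and not just up to isomorphism.
\<close>

definition seg :: "(nat \<times> nat \<Rightarrow> bool) \<Rightarrow> nat \<Rightarrow> nat \<Rightarrow> ograph" where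
  "seg X u v = (v - u, \<lambda>i j. i \<noteq> j \<and> max i j < v - u \<and> X (u + 1 + min i j, u + 1 + max i j))"

definition is_cut :: "nat \<Rightarrow> (nat \<times> nat \<Rightarrow> bool) \<Rightarrow> nat \<Rightarrow> bool" where
  "is_cut n X c \<longleftrightarrow> (\<forall>a b. 1 \<le> a \<and> a \<le> c \<and> c < b \<and> b \<le> n \<longrightarrow> \<not> X (a, b))"

lemma fst_seg [simp]: "fst (seg X u v) = v - u"
  by (simp add: seg_def)

lemma seg_shift:
  assumes "\<And>a b. u < a \<Longrightarrow> a < b \<Longrightarrow> b \<le> v \<Longrightarrow> Y (a, b) = X (a + s, b + s)"
  shows "seg Y u v = seg X (u + s) (v + s)"
proof -
  have "(i \<noteq> j \<and> max i j < v - u \<and> Y (u + 1 + min i j, u + 1 + max i j)) \<longleftrightarrow>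
      (i \<noteq> j \<and> max i j < v + s - (u + s) \<and> X (u + s + 1 + min i j, u + s + 1 + max i j))" for i j
    using assms[of "u + 1 + min i j" "u + 1 + max i j"]
    by (cases "i < j"; cases "j < i") (auto simp: add_ac)
  then show ?thesis by (simp add: seg_def)
qed

lemma seg_split:
  assumes "u \<le> c" "c \<le> v" "v \<le> n" "is_cut n X c"
  shows "seg X u v = seg X u c \<oplus> seg X c v"
proof -
  have across: "\<not> X (Suc (u + a), Suc (u + b))" if "a < c - u" "c - u \<le> b" "b < v - u" for a b
  proof -
    have "Suc (u + a) \<le> c" "c < Suc (u + b)" "Suc (u + b) \<le> n" using that assms(1-3) by linarith+
    then show ?thesis using assms(4) unfolding is_cut_def by simp
  qed
  have "snd (seg X u v) i j = snd (seg X u c \<oplus> seg X c v) i j" for i j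
  proof -
    consider "i < c - u" "j < c - u" | "c - u \<le> i" "c - u \<le> j"
      | "i < c - u" "c - u \<le> j" | "c - u \<le> i" "j < c - u" by linarith
    then show ?thesis
    proof cases
      case 1
      then show ?thesis using assms by (auto simp: seg_def osum_def)
    next
      case 2
      then obtain i' j' where ij: "i = c - u + i'" "j = c - u + j'" by (meson le_Suc_ex)
      have "snd (seg X u c \<oplus> seg X c v) i j = snd (seg X c v) i' j'"
        using ij by (simp add: osum_def)
      moreover have "u + 1 + min i j = c + 1 + min i' j'" "u + 1 + max i j = c + 1 + max i' j'"
        "i \<noteq> j \<longleftrightarrow> i' \<noteq> j'" "max i j < v - u \<longleftrightarrow> max i' j' < v - c"
        using ij assms(1,2) by auto
      ultimately show ?thesis by (simp only: seg_def snd_conv)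
    next
      case 3
      then have "\<not> snd (seg X u v) i j"
        using across by (auto simp: seg_def)
      then show ?thesis using 3 by (simp add: osum_def)
    next
      case 4
      then have "\<not> snd (seg X u v) i j"
        using across by (auto simp: seg_def)
      then show ?thesis using 4 by (simp add: osum_def)
    qed
  qed
  then show ?thesis using assms(1,2) by (simp add: prod_eq_iff fun_eq_iff)
qed

definition true_in :: "fm \<Rightarrow> ograph \<Rightarrow> bool" where
  "true_in \<psi> x \<longleftrightarrow> models {..<fst x} (snd x) (\<le>) \<psi>"

lemma models_ef:
  assumes "ef k A U B V {}" "qr \<psi> \<le> k" "sentence \<psi>"
  shows "models U A (\<le>) \<psi> \<longleftrightarrow> models V B (\<le>) \<psi>"
  unfolding models_def
proof (intro iff_allI)
  show "sat U A (\<le>) s \<psi> \<longleftrightarrow> sat V B (\<le>) s \<psi>" for s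
    by (rule ef_sat[OF assms(1,2)]) (use assms(3) in \<open>simp add: sentence_def\<close>)
qed

lemma true_in_eqv: "eqv k x y \<Longrightarrow> qr \<psi> \<le> k \<Longrightarrow> sentence \<psi> \<Longrightarrow> true_in \<psi> x \<longleftrightarrow> true_in \<psi> y"
  unfolding true_in_def game_def by (rule models_ef)

lemma models_iff_true_in_seg:
  assumes "sentence \<psi>" "\<And>a b. X (a, b) \<Longrightarrow> a < b"
  shows "models {1..n} (\<lambda>v w. X (v, w) \<or> X (w, v)) (\<le>) \<psi> \<longleftrightarrow> true_in \<psi> (seg X 0 n)"
proof -
  let ?A = "\<lambda>v w. X (v, w) \<or> X (w, v)"
  have "snd (seg X 0 n) i j \<longleftrightarrow> ?A (Suc i) (Suc j)" if "i < n" "j < n" for i j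
    using that assms(2)[of "Suc i" "Suc j"] assms(2)[of "Suc j" "Suc i"]
    by (cases i j rule: linorder_cases) (auto simp: seg_def dest: assms(2))
  then have "ef (qr \<psi>) (snd (seg X 0 n)) ((\<lambda>i. i) ` {..<n}) ?A (Suc ` {..<n}) (map_prod (\<lambda>i. i) Suc ` {})"
    by (intro ef_embed[where A = "snd (seg X 0 n)" and B = "snd (seg X 0 n)"]) (auto simp: ef_refl)
  moreover have "Suc ` {..<n} = {1..n}"
    by (simp add: lessThan_atLeast0 atLeastLessThanSuc_atLeastAtMost)
  ultimately have "ef (qr \<psi>) (snd (seg X 0 n)) {..<n} ?A {1..n} {}" by simp
  then show ?thesis using assms(1) unfolding true_in_def by (simp add: models_ef)
qed

text \<open>
  The window around the copy extends it by \<open>l\<close> vertices on both sides. Only pairs inside of the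
  window are inspected, so that disjoint windows are independent; an edge that leaves the window and
  crosses a border of the copy is longer than \<open>l\<close>, and those are treated separately.
\<close>

definition copy_at :: "nat \<Rightarrow> ograph \<Rightarrow> (nat \<times> nat \<Rightarrow> bool) \<Rightarrow> nat \<Rightarrow> bool" where
  "copy_at l w X u \<longleftrightarrow>
     (\<forall>i j. i < j \<and> j < fst w \<longrightarrow> X (u + 1 + i, u + 1 + j) = snd w i j) \<and>
     (\<forall>a b. u < a + l \<and> b \<le> u + fst w + l \<and> (a \<le> u \<and> u < b \<or> a \<le> u + fst w \<and> u + fst w < b)
        \<longrightarrow> \<not> X (a, b))"

lemma copy_at_shift:
  assumes "l \<le> u"
    and eq: "\<And>a b. u < a + l \<Longrightarrow> a < b \<Longrightarrow> b \<le> u + fst w + l \<Longrightarrow> Y (a, b) = X (a + s, b + s)"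
  shows "copy_at l w Y u \<longleftrightarrow> copy_at l w X (u + s)"
proof -
  have "Y (u + 1 + i, u + 1 + j) = X (u + s + 1 + i, u + s + 1 + j)" if "i < j" "j < fst w" for i j
    using eq[of "u + 1 + i" "u + 1 + j"] that by (simp add: add_ac)
  moreover have "(\<forall>a b. u < a + l \<and> b \<le> u + fst w + l \<and>
          (a \<le> u \<and> u < b \<or> a \<le> u + fst w \<and> u + fst w < b) \<longrightarrow> \<not> Y (a, b)) \<longleftrightarrow>
      (\<forall>a b. u + s < a + l \<and> b \<le> u + s + fst w + l \<and>
          (a \<le> u + s \<and> u + s < b \<or> a \<le> u + s + fst w \<and> u + s + fst w < b) \<longrightarrow> \<not> X (a, b))"
    (is "?L = ?R")
  proof
    assume L: ?L
    show ?R
    proof (intro allI impI)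
      fix a b
      assume *: "u + s < a + l \<and> b \<le> u + s + fst w + l \<and>
          (a \<le> u + s \<and> u + s < b \<or> a \<le> u + s + fst w \<and> u + s + fst w < b)"
      then have "s \<le> a" "s \<le> b" using assms(1) by auto
      then obtain a' b' where ab: "a = a' + s" "b = b' + s" by (metis le_add_diff_inverse2)
      then show "\<not> X (a, b)" using * L eq[of a' b'] by (auto simp: add_ac)
    qed
  next
    assume R: ?R
    show ?L
    proof (intro allI impI)
      fix a b
      assume *: "u < a + l \<and> b \<le> u + fst w + l \<and>
          (a \<le> u \<and> u < b \<or> a \<le> u + fst w \<and> u + fst w < b)"
      then show "\<not> Y (a, b)" using R[rule_format, of "a + s" "b + s"] eq[of a b] by (auto simp: add_ac)
    qed
  qed
  ultimately show ?thesis unfolding copy_at_def by simp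
qed

definition long_edge :: "nat \<Rightarrow> nat \<Rightarrow> (nat \<times> nat \<Rightarrow> bool) \<Rightarrow> nat \<Rightarrow> bool" where
  "long_edge l n X c \<longleftrightarrow> (\<exists>a b. 1 \<le> a \<and> a \<le> c \<and> c < b \<and> b \<le> n \<and> l < b - a \<and> X (a, b))"

lemma copy_at_cuts:
  assumes "copy_at l w X u" "\<not> long_edge l n X u" "\<not> long_edge l n X (u + fst w)"
  shows "is_cut n X u" "is_cut n X (u + fst w)"
proof -
  have local: "\<not> X (a, b)" if "u < a + l" "b \<le> u + fst w + l"
      "a \<le> u \<and> u < b \<or> a \<le> u + fst w \<and> u + fst w < b" for a b
    using assms(1) that unfolding copy_at_def by blast
  show "is_cut n X u" unfolding is_cut_def
  proof (intro allI impI notI)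
    fix a b assume ab: "1 \<le> a \<and> a \<le> u \<and> u < b \<and> b \<le> n" and X: "X (a, b)"
    have "\<not> l < b - a" using assms(2) ab X unfolding long_edge_def by blast
    then have "u < a + l" "b \<le> u + fst w + l" using ab by linarith+
    then show False using local[of a b] ab X by blast
  qed
  show "is_cut n X (u + fst w)" unfolding is_cut_def
  proof (intro allI impI notI)
    fix a b assume ab: "1 \<le> a \<and> a \<le> u + fst w \<and> u + fst w < b \<and> b \<le> n" and X: "X (a, b)"
    have "\<not> l < b - a" using assms(3) ab X unfolding long_edge_def by blast
    then have "u < a + l" "b \<le> u + fst w + l" using ab by linarith+
    then show False using local[of a b] ab X by blast
  qed
qed

text \<open>
  The graphs that may occur between two cuts. Restricting to them matters when some \<open>p i\<close>
  vanish: an absorbing graph has to occur with positive probability.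
\<close>

definition admissible :: "(nat \<Rightarrow> real) \<Rightarrow> ograph set" where
  "admissible p = {x. \<forall>i<fst x. \<forall>j<fst x.
     (snd x i j \<longleftrightarrow> snd x j i) \<and> (snd x i j \<longrightarrow> i \<noteq> j \<and> (i < j \<longrightarrow> p (j - i) > 0))}"

lemma admissible_osum:
  assumes "x \<in> admissible p" "y \<in> admissible p"
  shows "x \<oplus> y \<in> admissible p"
proof -
  have x: "(snd x i j \<longleftrightarrow> snd x j i) \<and> (snd x i j \<longrightarrow> i \<noteq> j \<and> (i < j \<longrightarrow> p (j - i) > 0))"
    if "i < fst x" "j < fst x" for i j
    using assms(1) that by (auto simp: admissible_def)
  have y: "(snd y i j \<longleftrightarrow> snd y j i) \<and> (snd y i j \<longrightarrow> i \<noteq> j \<and> (i < j \<longrightarrow> p (j - i) > 0))"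
    if "i < fst y" "j < fst y" for i j
    using assms(2) that by (auto simp: admissible_def)
  have "(snd (x \<oplus> y) i j \<longleftrightarrow> snd (x \<oplus> y) j i) \<and>
      (snd (x \<oplus> y) i j \<longrightarrow> i \<noteq> j \<and> (i < j \<longrightarrow> p (j - i) > 0))"
    if ij: "i < fst x + fst y" "j < fst x + fst y" for i j
  proof -
    consider "i < fst x" "j < fst x" | "fst x \<le> i" "fst x \<le> j"
      | "i < fst x \<longleftrightarrow> \<not> j < fst x" by linarith
    then show ?thesis
    proof cases
      case 1
      then show ?thesis using x[of i j] by (simp add: osum_def)
    next
      case 2
      then obtain i' j' where "i = fst x + i'" "j = fst x + j'" by (meson le_Suc_ex)
      then show ?thesis using y[of i' j'] ij by (simp add: osum_def)
    next
      case 3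
      then show ?thesis by (auto simp: osum_def)
    qed
  qed
  then show ?thesis by (simp add: admissible_def)
qed

lemma admissible_seg:
  assumes "\<And>a b. a < b \<Longrightarrow> X (a, b) \<Longrightarrow> p (b - a) > 0"
  shows "seg X u v \<in> admissible p"
  using assms[of "Suc (u + i)" "Suc (u + j)" for i j]
  by (auto simp: admissible_def seg_def min.commute max.commute)

text \<open>
  Between two isolated copies of an absorbing graph \<open>w\<close> everything may be forgotten: only the parts
  to the left of the first and to the right of the second copy matter.
\<close>

lemma eqv_outer_parts:
  assumes w: "w \<in> admissible p" "\<And>x. x \<in> admissible p \<Longrightarrow> eqv k (w \<oplus> (x \<oplus> w)) w"
    and X: "\<And>a b. a < b \<Longrightarrow> X (a, b) \<Longrightarrow> p (b - a) > 0"
    and uv: "u + fst w \<le> v" "v + fst w \<le> n"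
    and copies: "copy_at l w X u" "copy_at l w X v"
    and short: "\<not> long_edge l n X u" "\<not> long_edge l n X (u + fst w)"
      "\<not> long_edge l n X v" "\<not> long_edge l n X (v + fst w)"
  shows "eqv k (seg X 0 n) (seg X 0 u \<oplus> (w \<oplus> seg X (v + fst w) n))"
proof -
  note cuts = copy_at_cuts[OF copies(1) short(1,2)] copy_at_cuts[OF copies(2) short(3,4)]
  define x y z where "x = seg X 0 u" and "y = seg X (u + fst w) v" and "z = seg X (v + fst w) n"
  have copy: "eqv k (seg X c (c + fst w)) w" if "copy_at l w X c" for c
  proof (rule eqvI_on_universe)
    show "snd (seg X c (c + fst w)) i j = snd w i j"
      if "i < fst (seg X c (c + fst w))" "j < fst (seg X c (c + fst w))" for i j
      using that \<open>copy_at l w X c\<close> w(1)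
      by (cases i j rule: linorder_cases) (auto simp: seg_def copy_at_def admissible_def)
  qed simp
  have "seg X 0 n = x \<oplus> seg X u n"
    unfolding x_def by (rule seg_split[where n = n]) (use uv cuts in auto)
  also have "seg X u n = seg X u (u + fst w) \<oplus> seg X (u + fst w) n"
    by (rule seg_split[where n = n]) (use uv cuts in auto)
  also have "seg X (u + fst w) n = y \<oplus> seg X v n"
    unfolding y_def by (rule seg_split[where n = n]) (use uv cuts in auto)
  also have "seg X v n = seg X v (v + fst w) \<oplus> z"
    unfolding z_def by (rule seg_split[where n = n]) (use uv cuts in auto)
  finally have "seg X 0 n = x \<oplus> (seg X u (u + fst w) \<oplus> (y \<oplus> (seg X v (v + fst w) \<oplus> z)))" .
  moreover have "eqv k \<dots> (x \<oplus> (w \<oplus> (y \<oplus> (w \<oplus> z))))"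
    by (intro eqv_osum eqv_refl copy copies)
  moreover have "x \<oplus> (w \<oplus> (y \<oplus> (w \<oplus> z))) = x \<oplus> ((w \<oplus> (y \<oplus> w)) \<oplus> z)"
    by (simp add: osum_assoc)
  moreover have "eqv k \<dots> (x \<oplus> (w \<oplus> z))"
    using w(2)[of y] admissible_seg[of X p "u + fst w" v] X
    unfolding y_def by (intro eqv_osum eqv_refl) blast
  ultimately show ?thesis unfolding x_def z_def using eqv_trans by metis
qed

section \<open>Products of distributions\<close>

text \<open>
  Coordinates outside of \<open>S\<close> carry the default val almost surely, so they may be attributed to
  either of the two events.
\<close>

lemma Pi_pmf_prob_Int:
  fixes q :: "'a \<Rightarrow> 'b pmf"
  assumes "finite S" "A \<subseteq> S"
    and E: "\<And>f g. (\<And>x. x \<in> A \<Longrightarrow> f x = g x) \<Longrightarrow> f \<in> E \<longleftrightarrow> g \<in> E"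
    and F: "\<And>f g. (\<And>x. x \<notin> A \<Longrightarrow> f x = g x) \<Longrightarrow> f \<in> F \<longleftrightarrow> g \<in> F"
  shows "measure_pmf.prob (Pi_pmf S d q) (E \<inter> F) =
    measure_pmf.prob (Pi_pmf S d q) E * measure_pmf.prob (Pi_pmf S d q) F"
proof -
  define M N where "M = Pi_pmf A d q" and "N = Pi_pmf (S - A) d q"
  let ?h = "\<lambda>(f, g) x. if x \<in> A then f x else g x"
  have "finite A" using assms(1,2) finite_subset by blast
  then have "Pi_pmf (A \<union> (S - A)) d q = map_pmf ?h (pair_pmf M N)"
    using assms(1) unfolding M_def N_def by (intro Pi_pmf_union) auto
  then have S: "Pi_pmf S d q = map_pmf ?h (pair_pmf M N)"
    using assms(2) by (simp add: Un_absorb1)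
  have hE: "?h (f, g) \<in> E \<longleftrightarrow> f \<in> E" for f g by (rule E) simp
  have hF: "?h (f, g) \<in> F \<longleftrightarrow> g \<in> F" for f g by (rule F) simp
  have prod: "measure_pmf.prob (pair_pmf M N) (B \<times> C) = measure_pmf.prob M B * measure_pmf.prob N C"
    for B C
  proof -
    have "measure_pmf.prob (pair_pmf M N) (B \<times> C) =
        measure_pmf.prob (pair_pmf M N) ((B \<inter> set_pmf M) \<times> (C \<inter> set_pmf N))"
      by (subst measure_Int_set_pmf [symmetric]) (auto intro!: arg_cong2[where f = measure])
    also have "\<dots> = measure_pmf.prob M (B \<inter> set_pmf M) * measure_pmf.prob N (C \<inter> set_pmf N)"
      by (rule measure_pmf_prob_product) (auto intro: countable_subset[OF _ countable_set_pmf])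
    finally show ?thesis by (simp add: measure_Int_set_pmf)
  qed
  have "?h -` (E \<inter> F) = E \<times> F" "?h -` E = E \<times> UNIV" "?h -` F = UNIV \<times> F"
    using hE hF by auto
  then show ?thesis
    unfolding S by (simp add: prod)
qed

lemma Pi_pmf_reindex:
  fixes q :: "'b \<Rightarrow> 'c pmf"
  assumes "finite T" "finite S" "inj_on \<phi> S" "\<phi> ` S \<subseteq> T" "\<And>e. e \<in> S \<Longrightarrow> q (\<phi> e) = q' e"
  shows "map_pmf (\<lambda>f e. if e \<in> S then f (\<phi> e) else d) (Pi_pmf T d q) = Pi_pmf S d q'"
proof -
  have bij: "map_pmf (\<lambda>f e. if e \<in> S then f (\<phi> e) else d) (Pi_pmf (\<phi> ` S) d q) = Pi_pmf S d q'"
    using assms(2,3,5)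
  proof (induction S rule: finite_induct)
    case (insert x S)
    let ?pull = "\<lambda>S f e. if e \<in> S then f (\<phi> e) else d"
    have x: "\<phi> x \<notin> \<phi> ` S" using insert by auto
    have pull: "?pull (insert x S) (f(\<phi> x := y)) = (?pull S f)(x := y)" for f y
    proof
      fix e
      have "\<phi> e \<noteq> \<phi> x" if "e \<in> S" using x that by (metis imageI)
      then show "?pull (insert x S) (f(\<phi> x := y)) e = ((?pull S f)(x := y)) e" by simp
    qed
    have "map_pmf (?pull (insert x S)) (Pi_pmf (\<phi> ` insert x S) d q) =
        map_pmf (?pull (insert x S)) (map_pmf (\<lambda>(y, f). f(\<phi> x := y))
          (pair_pmf (q (\<phi> x)) (Pi_pmf (\<phi> ` S) d q)))"
      using x insert(1) by (simp add: Pi_pmf_insert)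
    also have "\<dots> = map_pmf (\<lambda>(y, f). (?pull S f)(x := y)) (pair_pmf (q (\<phi> x)) (Pi_pmf (\<phi> ` S) d q))"
      unfolding pmf.map_comp
    proof (rule map_pmf_cong[OF refl])
      show "(?pull (insert x S) \<circ> (\<lambda>(y, f). f(\<phi> x := y))) z = (\<lambda>(y, f). (?pull S f)(x := y)) z" for z
        by (cases z) (simp only: o_apply prod.case pull)
    qed
    also have "\<dots> = map_pmf (\<lambda>(y, f). f(x := y))
        (pair_pmf (q' x) (map_pmf (?pull S) (Pi_pmf (\<phi> ` S) d q)))"
      using insert.prems by (simp add: pair_map_pmf2 pmf.map_comp o_def case_prod_unfold)
    also have "\<dots> = Pi_pmf (insert x S) d q'"
      using insert by (simp add: Pi_pmf_insert)
    finally show ?case .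
  qed simp
  have "Pi_pmf S d q' = map_pmf (\<lambda>f e. if e \<in> S then f (\<phi> e) else d)
      (map_pmf (\<lambda>f e. if e \<in> \<phi> ` S then f e else d) (Pi_pmf T d q))"
    unfolding bij[symmetric] by (subst Pi_pmf_subset[OF assms(1,4)]) simp
  also have "\<dots> = map_pmf (\<lambda>f e. if e \<in> S then f (\<phi> e) else d) (Pi_pmf T d q)"
    by (simp add: pmf.map_comp o_def cong: if_cong) 
  finally show ?thesis by simp
qed

lemma prob_diff_le:
  fixes M :: "'a pmf"
  assumes "\<And>x. x \<in> set_pmf M \<Longrightarrow> x \<notin> B \<Longrightarrow> x \<in> E \<longleftrightarrow> x \<in> F"
  shows "\<bar>measure_pmf.prob M E - measure_pmf.prob M F\<bar> \<le> measure_pmf.prob M B"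
proof -
  have *: "measure_pmf.prob M E \<le> measure_pmf.prob M F + measure_pmf.prob M B"
    if "\<And>x. x \<in> set_pmf M \<Longrightarrow> x \<notin> B \<Longrightarrow> x \<in> E \<Longrightarrow> x \<in> F" for E F
  proof -
    have "measure_pmf.prob M E = measure_pmf.prob M (E \<inter> set_pmf M)" by (simp add: measure_Int_set_pmf)
    also have "\<dots> \<le> measure_pmf.prob M (F \<union> B)"
      using that by (intro measure_pmf.finite_measure_mono) auto
    also have "\<dots> \<le> measure_pmf.prob M F + measure_pmf.prob M B"
      by (rule measure_Un_le) auto
    finally show ?thesis .
  qed
  show ?thesis using *[of E F] *[of F E] assms by auto
qed

section \<open>Cuts and copies in the random graph\<close>

text \<open>The convergence hypothesis enters through the partial products, which decrease to \<open>P\<close>.\<close>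

locale rapid_decay =
  fixes p :: "nat \<Rightarrow> real" and P :: real
  assumes p_bounds: "\<And>i. 1 \<le> i \<Longrightarrow> 0 \<le> p i \<and> p i \<le> 1"
    and P_pos: "0 < P"
    and P_le_prod: "\<And>n. P \<le> (\<Prod>d=1..n. (1 - p d) ^ d)"
begin

lemma p_less_1: "1 \<le> i \<Longrightarrow> p i < 1"
proof (rule ccontr)
  assume i: "1 \<le> i" "\<not> p i < 1"
  then have "(1 - p i) ^ i = 0" using p_bounds[of i] by (auto simp: power_0_left)
  then have "(\<Prod>d=1..i. (1 - p d) ^ d) = 0" using i(1) by (intro prod_zero) auto
  then show False using P_le_prod[of i] P_pos by linarith
qed

text \<open>As \<open>1 - x \<le> exp (- x)\<close>, the sums of \<open>d * p d\<close> are bounded by \<open>- ln P\<close>.\<close>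

lemma small_tails:
  assumes "0 < e"
  obtains l where "\<And>n. (\<Sum>d\<in>{l<..n}. real d * p d) < e"
proof -
  define f where "f d = (if d = 0 then 0 else real d * p d)" for d
  have f: "0 \<le> f d" for d using p_bounds[of d] by (auto simp: f_def)
  have "(\<Sum>d<n. f d) \<le> - ln P" for n
  proof -
    have "P \<le> (\<Prod>d=1..n. (1 - p d) ^ d)" by (rule P_le_prod)
    also have "\<dots> \<le> (\<Prod>d=1..n. exp (- f d))"
    proof (rule prod_mono)
      fix d assume d: "d \<in> {1..n}"
      have "1 - p d \<le> exp (- p d)" using exp_ge_add_one_self[of "- p d"] by simp
      then have "(1 - p d) ^ d \<le> exp (- p d) ^ d" using p_bounds[of d] d by (intro power_mono) auto
      also have "\<dots> = exp (- f d)" using d by (simp add: f_def exp_of_nat_mult [symmetric])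
      finally show "0 \<le> (1 - p d) ^ d \<and> (1 - p d) ^ d \<le> exp (- f d)" using p_bounds[of d] d by simp
    qed
    also have "\<dots> = exp (- (\<Sum>d=1..n. f d))" by (simp add: exp_sum sum_negf [symmetric])
    finally have "ln P \<le> - (\<Sum>d=1..n. f d)" 
      using P_pos by (metis ln_exp ln_le_cancel_iff exp_gt_zero)
    moreover have "(\<Sum>d<n. f d) \<le> (\<Sum>d\<in>{0..n}. f d)" using f by (intro sum_mono2) auto
    moreover have "(\<Sum>d\<in>{0..n}. f d) = (\<Sum>d=1..n. f d)"
      by (simp add: sum.atLeast_Suc_atMost f_def)
    ultimately show ?thesis by simp
  qed
  then have "summable f" by (intro summableI_nonneg_bounded[OF f])
  then obtain l where l: "\<And>m n. l \<le> m \<Longrightarrow> norm (sum f {m..<n}) < e"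
    using assms unfolding summable_Cauchy by blast
  have "(\<Sum>d\<in>{l<..n}. real d * p d) < e" for n
  proof -
    have "(\<Sum>d\<in>{l<..n}. real d * p d) = sum f {Suc l..<Suc n}"
      by (rule sum.cong) (auto simp: f_def)
    also have "\<dots> < e" using l[of "Suc l" "Suc n"] by (simp add: abs_less_iff)
    finally show ?thesis .
  qed
  then show ?thesis using that by blast
qed

definition crossing :: "nat \<Rightarrow> nat \<Rightarrow> (nat \<times> nat) set" where
  "crossing n c = {(a, b). 1 \<le> a \<and> a \<le> c \<and> c < b \<and> b \<le> n}"

lemma finite_vertex_pairs: "finite (vertex_pairs n)"
  by (rule finite_subset[of _ "{..n} \<times> {..n}"]) (auto simp: vertex_pairs_def)

lemma crossing_subset: "crossing n c \<subseteq> vertex_pairs n"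
  by (auto simp: crossing_def vertex_pairs_def)

lemma finite_crossing: "finite (crossing n c)"
  using crossing_subset finite_vertex_pairs by (rule finite_subset)

text \<open>
  At most \<open>d\<close> pairs at distance \<open>d\<close> cross a given cut, which is where the exponents in the
  hypothesis come from: a crossing pair is determined by its distance and the distance of
  its left end from the cut.
\<close>

lemma crossing_by_distance:
  "inj_on (\<lambda>(a, b). (b - a, c - a)) (crossing n c)"
  "(a, b) \<in> crossing n c \<Longrightarrow> (b - a, c - a) \<in> Sigma {1..n} (\<lambda>d. {..<d})"
  by (auto simp: inj_on_def crossing_def)

lemma prod_crossing: "P \<le> (\<Prod>(a, b)\<in>crossing n c. 1 - p (b - a))"
proof -
  let ?T = "Sigma {1..n} (\<lambda>d. {..<d})" and ?f = "\<lambda>(d, k::nat). 1 - p d"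
  let ?I = "(\<lambda>(a, b). (b - a, c - a)) ` crossing n c"
  have I: "?I \<subseteq> ?T" using crossing_by_distance(2) by auto
  have bounds: "0 \<le> ?f x \<and> ?f x \<le> 1" if "x \<in> ?T" for x using that p_bounds by auto
  have "P \<le> (\<Prod>d=1..n. (1 - p d) ^ d)" by (rule P_le_prod)
  also have "\<dots> = prod ?f ?T" by (simp add: prod.Sigma [symmetric])
  also have "\<dots> = prod ?f ?I * prod ?f (?T - ?I)"
    using I by (subst prod.subset_diff[OF I]) (auto simp: mult.commute)
  also have "\<dots> \<le> prod ?f ?I * 1"
    using bounds I by (intro mult_left_mono prod_le_1 prod_nonneg) auto
  also have "prod ?f ?I = (\<Prod>(a, b)\<in>crossing n c. 1 - p (b - a))"
    by (subst prod.reindex[OF crossing_by_distance(1)]) (auto intro: prod.cong)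
  finally show ?thesis by simp
qed

lemma sum_long_crossing:
  "(\<Sum>(a, b)\<in>{(a, b)\<in>crossing n c. l < b - a}. p (b - a)) \<le> (\<Sum>d\<in>{l<..n}. real d * p d)"
proof -
  let ?C = "{(a, b)\<in>crossing n c. l < b - a}"
  let ?T = "Sigma {l<..n} (\<lambda>d. {..<d})" and ?f = "\<lambda>(d, k::nat). p d"
  let ?I = "(\<lambda>(a, b). (b - a, c - a)) ` ?C"
  have inj: "inj_on (\<lambda>(a, b). (b - a, c - a)) ?C"
    using crossing_by_distance(1) by (rule inj_on_subset) auto
  have I: "?I \<subseteq> ?T" using crossing_by_distance(2) by fastforce
  have "(\<Sum>(a, b)\<in>?C. p (b - a)) = sum ?f ?I"
    by (subst sum.reindex[OF inj]) (auto intro: sum.cong)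
  also have "\<dots> \<le> sum ?f ?T"
    using I p_bounds by (intro sum_mono2) auto
  also have "\<dots> = (\<Sum>d\<in>{l<..n}. real d * p d)" by (simp add: sum.Sigma [symmetric])
  finally show ?thesis .
qed

abbreviation edge_pmf :: "nat \<times> nat \<Rightarrow> bool pmf" where
  "edge_pmf \<equiv> \<lambda>(v, w). bernoulli_pmf (p (w - v))"

abbreviation G :: "nat \<Rightarrow> (nat \<times> nat \<Rightarrow> bool) pmf" where
  "G n \<equiv> Pi_pmf (vertex_pairs n) False edge_pmf"

lemma prob_edge:
  assumes "(a, b) \<in> vertex_pairs n"
  shows "measure_pmf.prob (G n) {X. X (a, b)} = p (b - a)"
proof -
  have "{X. X (a, b)} = (\<lambda>X. X (a, b)) -` {True}" by auto
  then have "measure_pmf.prob (G n) {X. X (a, b)} =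
      measure_pmf.prob (map_pmf (\<lambda>X. X (a, b)) (G n)) {True}" by simp
  also have "\<dots> = pmf (bernoulli_pmf (p (b - a))) True"
    using assms finite_vertex_pairs by (simp add: Pi_pmf_component measure_pmf_single)
  also have "\<dots> = p (b - a)" using assms p_bounds[of "b - a"] by (auto simp: vertex_pairs_def)
  finally show ?thesis .
qed

lemma prob_long_edge:
  "measure_pmf.prob (G n) {X. long_edge l n X c} \<le> (\<Sum>d\<in>{l<..n}. real d * p d)"
proof -
  let ?C = "{(a, b)\<in>crossing n c. l < b - a}"
  have "finite ?C" using finite_crossing by (rule rev_finite_subset) auto
  have "{X. long_edge l n X c} = (\<Union>e\<in>?C. {X. X e})"
    by (auto simp: long_edge_def crossing_def)
  then have "measure_pmf.prob (G n) {X. long_edge l n X c} \<le>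
      (\<Sum>e\<in>?C. measure_pmf.prob (G n) {X. X e})"
    using \<open>finite ?C\<close> by (simp add: measure_pmf.finite_measure_subadditive_finite)
  also have "\<dots> = (\<Sum>(a, b)\<in>?C. p (b - a))"
    using crossing_subset by (intro sum.cong) (auto simp: prob_edge subset_iff)
  also have "\<dots> \<le> (\<Sum>d\<in>{l<..n}. real d * p d)" by (rule sum_long_crossing)
  finally show ?thesis .
qed

text \<open>
  A lower bound for the probability of an isolated copy of \<open>w\<close>, with one factor \<open>P\<close> for each of its
  two borders. It is uniform in the margin \<open>l\<close>, so the number of windows can be fixed before \<open>l\<close>.
\<close>

definition copy_prob :: "ograph \<Rightarrow> real" where
  "copy_prob w =
     (\<Prod>(i, j)\<in>{(i, j). i < j \<and> j < fst w}. if snd w i j then p (j - i) else 1 - p (j - i)) * (P * P)"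

lemma copy_prob_pos:
  assumes "w \<in> admissible p"
  shows "0 < copy_prob w"
proof -
  have "0 < (\<Prod>(i, j)\<in>{(i, j). i < j \<and> j < fst w}. if snd w i j then p (j - i) else 1 - p (j - i))"
    using assms by (intro prod_pos) (auto simp: admissible_def p_less_1)
  then show ?thesis using P_pos by (simp add: copy_prob_def)
qed

text \<open>
  The event is bounded from below by the one that prescribes all pairs inside of the copy and forbids
  all edges crossing one of its borders. A pair crossing both borders contributes its factor
  twice, which only lowers the bound.
\<close>

lemma prob_copy_at:
  assumes "u + fst w \<le> n"
  shows "copy_prob w \<le> measure_pmf.prob (G n) {X. copy_at l w X u}"
proof -
  define I where "I = {(i, j). i < j \<and> j < fst w}"
  define h where "h = (\<lambda>(i, j). (u + 1 + i, u + 1 + j))"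
  define val where "val = (\<lambda>(a, b). snd w (a - u - 1) (b - u - 1))"
  define B where "B e = (if e \<in> crossing n u \<union> crossing n (u + fst w) then {False}
    else if e \<in> h ` I then {val e} else UNIV)" for e
  define cross where "cross c e = (if e \<in> crossing n c then case e of (a, b) \<Rightarrow> 1 - p (b - a) else 1)" for c e
  define inner where "inner e = (if e \<in> h ` I then case e of (a, b) \<Rightarrow>
    if val e then p (b - a) else 1 - p (b - a) else 1)" for e
  have hI: "h ` I \<subseteq> vertex_pairs n"
    using assms by (auto simp: h_def I_def vertex_pairs_def)
  have inj: "inj_on h I" by (auto simp: inj_on_def h_def)
  have "PiE_dflt (vertex_pairs n) False B \<subseteq> {X. copy_at l w X u}"
  proof clarify
    fix X assume X: "X \<in> PiE_dflt (vertex_pairs n) False B"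
    have inside: "X e \<in> B e" if "e \<in> vertex_pairs n" for e
      using X that by (cases e) (simp add: PiE_dflt_def)
    have cross: "\<not> X e" if "e \<in> crossing n u \<union> crossing n (u + fst w)" for e
      using inside[of e] that crossing_subset by (auto simp: B_def)
    have outside: "\<not> X e" if "e \<notin> vertex_pairs n" for e
      using X that by (cases e) (simp add: PiE_dflt_def)
    show "copy_at l w X u"
      unfolding copy_at_def
    proof (intro conjI allI impI)
      fix i j assume ij: "i < j \<and> j < fst w"
      define e where "e = (u + 1 + i, u + 1 + j)"
      have "e \<in> h ` I" using ij by (auto simp: h_def I_def e_def)
      moreover have "e \<notin> crossing n u \<union> crossing n (u + fst w)"
        using ij by (auto simp: crossing_def e_def)
      ultimately have "B e = {val e}" by (simp add: B_def)
      moreover have "e \<in> vertex_pairs n" using \<open>e \<in> h ` I\<close> hI by blast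
      ultimately have "X e = val e" using inside[of e] by simp
      then show "X (u + 1 + i, u + 1 + j) = snd w i j" by (simp add: e_def val_def)
    next
      fix a b
      assume "u < a + l \<and> b \<le> u + fst w + l \<and> (a \<le> u \<and> u < b \<or> a \<le> u + fst w \<and> u + fst w < b)"
      then show "\<not> X (a, b)"
        using cross[of "(a, b)"] outside[of "(a, b)"] by (auto simp: crossing_def vertex_pairs_def)
    qed
  qed
  then have "measure_pmf.prob (G n) (PiE_dflt (vertex_pairs n) False B)
      \<le> measure_pmf.prob (G n) {X. copy_at l w X u}"
    by (intro measure_pmf.finite_measure_mono) auto
  moreover have "measure_pmf.prob (G n) (PiE_dflt (vertex_pairs n) False B)
      = (\<Prod>e\<in>vertex_pairs n. measure_pmf.prob (edge_pmf e) (B e))"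
    by (rule measure_Pi_pmf_PiE_dflt[OF finite_vertex_pairs])
  moreover have "(\<Prod>e\<in>vertex_pairs n. inner e * (cross u e * cross (u + fst w) e))
      \<le> (\<Prod>e\<in>vertex_pairs n. measure_pmf.prob (edge_pmf e) (B e))"
  proof (rule prod_mono)
    fix e assume e: "e \<in> vertex_pairs n"
    obtain a b where ab: "e = (a, b)" by (cases e)
    have p: "0 \<le> p (b - a)" "p (b - a) \<le> 1" using e ab p_bounds[of "b - a"] by (auto simp: vertex_pairs_def)
    have prob: "measure_pmf.prob (edge_pmf e) {x} = (if x then p (b - a) else 1 - p (b - a))" for x
      using p by (simp add: ab measure_pmf_single)
    \<comment> \<open>the factor of \<open>e\<close> thus comes from \<open>inner\<close> or from \<open>cross\<close>, never from both\<close>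
    have disjoint: "e \<notin> h ` I" if "e \<in> crossing n u \<union> crossing n (u + fst w)"
      using that by (auto simp: h_def I_def crossing_def)
    have "0 \<le> inner e" "0 \<le> cross u e" "0 \<le> cross (u + fst w) e"
      using p by (auto simp: inner_def cross_def ab)
    moreover have "inner e * (cross u e * cross (u + fst w) e) \<le> measure_pmf.prob (edge_pmf e) (B e)"
    proof (cases "e \<in> crossing n u \<union> crossing n (u + fst w)")
      case True
      then have "inner e = 1" "measure_pmf.prob (edge_pmf e) (B e) = 1 - p (b - a)"
        using disjoint prob by (simp_all add: inner_def B_def)
      moreover have "cross u e * cross (u + fst w) e \<le> 1 - p (b - a)"
        using True p mult_left_le[of "1 - p (b - a)" "1 - p (b - a)"] by (auto simp: cross_def ab)
      ultimately show ?thesis by simp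
    next
      case False
      then have "cross u e = 1" "cross (u + fst w) e = 1" by (simp_all add: cross_def)
      moreover have "inner e = measure_pmf.prob (edge_pmf e) (B e)"
        using False prob by (cases "e \<in> h ` I") (simp_all add: inner_def B_def ab)
      ultimately show ?thesis by simp
    qed
    ultimately show "0 \<le> inner e * (cross u e * cross (u + fst w) e) \<and>
        inner e * (cross u e * cross (u + fst w) e) \<le> measure_pmf.prob (edge_pmf e) (B e)" by simp
  qed
  moreover have "copy_prob w \<le> (\<Prod>e\<in>vertex_pairs n. inner e * (cross u e * cross (u + fst w) e))"
  proof -
    have cross: "P \<le> prod (cross c) (vertex_pairs n)" for c
    proof -
      have "prod (cross c) (vertex_pairs n) =
          (\<Prod>e\<in>vertex_pairs n \<inter> crossing n c. case e of (a, b) \<Rightarrow> 1 - p (b - a))"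
        unfolding cross_def by (rule prod.inter_restrict[OF finite_vertex_pairs, symmetric])
      also have "vertex_pairs n \<inter> crossing n c = crossing n c" using crossing_subset by blast
      finally show ?thesis using prod_crossing by simp
    qed
    have "prod inner (vertex_pairs n) =
        (\<Prod>e\<in>vertex_pairs n \<inter> h ` I. case e of (a, b) \<Rightarrow> if val e then p (b - a) else 1 - p (b - a))"
      unfolding inner_def by (rule prod.inter_restrict[OF finite_vertex_pairs, symmetric])
    also have "vertex_pairs n \<inter> h ` I = h ` I" using hI by blast
    also have "(\<Prod>e\<in>h ` I. case e of (a, b) \<Rightarrow> if val e then p (b - a) else 1 - p (b - a))
        = (\<Prod>(i, j)\<in>I. if snd w i j then p (j - i) else 1 - p (j - i))"
      by (subst prod.reindex[OF inj]) (auto simp: h_def val_def intro!: prod.cong)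
    finally have inner: "prod inner (vertex_pairs n) = \<dots>" .
    have "0 \<le> (\<Prod>(i, j)\<in>I. if snd w i j then p (j - i) else 1 - p (j - i))"
      using p_bounds by (intro prod_nonneg) (auto simp: I_def)
    then show ?thesis
      unfolding copy_prob_def prod.distrib inner I_def[symmetric]
      using cross P_pos by (intro mult_left_mono mult_mono) (auto intro: order_trans less_imp_le)
  qed
  ultimately show ?thesis by simp
qed

section \<open>Copies near both ends\<close>

text \<open>
  Windows of width \<open>2 * l + fst w\<close> are laid out consecutively after the vertex \<open>t\<close>; the vertex
  described here is the last one before the middle part of the \<open>j\<close>-th window.
\<close>

definition position :: "nat \<Rightarrow> ograph \<Rightarrow> nat \<Rightarrow> nat \<Rightarrow> nat" where
  "position l w t j = t + j * (2 * l + fst w) + l"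

lemma position_less:
  assumes "j < J"
  shows "position l w t j + fst w + l \<le> t + J * (2 * l + fst w)"
proof -
  have "Suc j * (2 * l + fst w) \<le> J * (2 * l + fst w)" using assms by (intro mult_right_mono) auto
  then show ?thesis by (simp add: position_def)
qed

text \<open>
  Disjoint windows are independent: the first \<open>J\<close> windows involve only pairs ending at or before
  \<open>t + J * (2 * l + fst w)\<close>, the next one only pairs ending after it.
\<close>

lemma prob_no_copy:
  assumes "t + J * (2 * l + fst w) \<le> n"
  shows "measure_pmf.prob (G n) {X. \<forall>j<J. \<not> copy_at l w X (position l w t j)} \<le> (1 - copy_prob w) ^ J"
  using assms
proof (induction J)
  case (Suc J)
  let ?D = "2 * l + fst w"
  let ?E = "{X. \<forall>j<J. \<not> copy_at l w X (position l w t j)}"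
  let ?F = "{X. \<not> copy_at l w X (position l w t J)}"
  let ?A = "{(a, b)\<in>vertex_pairs n. b \<le> t + J * ?D}"
  have bound: "position l w t J + fst w \<le> n"
    using Suc.prems by (simp add: position_def)
  have F: "measure_pmf.prob (G n) ?F \<le> 1 - copy_prob w"
  proof -
    have "?F = space (measure_pmf (G n)) - {X. copy_at l w X (position l w t J)}" by auto
    then have "measure_pmf.prob (G n) ?F = 1 - measure_pmf.prob (G n) {X. copy_at l w X (position l w t J)}"
      by (simp only:) (rule measure_pmf.prob_compl, simp)
    then show ?thesis using prob_copy_at[OF bound, of l] by simp
  qed
  have E_cong: "X \<in> ?E \<longleftrightarrow> Y \<in> ?E" if XY: "\<And>e. e \<in> ?A \<Longrightarrow> X e = Y e" for X Y
  proof -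
    have "copy_at l w X (position l w t j) \<longleftrightarrow> copy_at l w Y (position l w t j)" if j: "j < J" for j
    proof -
      have "copy_at l w X (position l w t j) \<longleftrightarrow> copy_at l w Y (position l w t j + 0)"
      proof (rule copy_at_shift)
        fix a b assume "position l w t j < a + l" "a < b" "b \<le> position l w t j + fst w + l"
        then have "(a, b) \<in> ?A"
          using position_less[OF j, of l w t] Suc.prems by (auto simp: vertex_pairs_def position_def)
        then show "X (a, b) = Y (a + 0, b + 0)" using XY by simp
      qed (simp add: position_def)
      then show ?thesis by simp
    qed
    then show ?thesis by simp
  qed
  have F_cong: "X \<in> ?F \<longleftrightarrow> Y \<in> ?F" if XY: "\<And>e. e \<notin> ?A \<Longrightarrow> X e = Y e" for X Y
  proof -
    have "copy_at l w X (position l w t J) \<longleftrightarrow> copy_at l w Y (position l w t J + 0)"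
    proof (rule copy_at_shift)
      fix a b assume "position l w t J < a + l" "a < b" "b \<le> position l w t J + fst w + l"
      then have "(a, b) \<notin> ?A" by (auto simp: position_def)
      then show "X (a, b) = Y (a + 0, b + 0)" using XY[of "(a, b)"] by simp
    qed (simp add: position_def)
    then show ?thesis by simp
  qed
  have "{X. \<forall>j<Suc J. \<not> copy_at l w X (position l w t j)} = ?E \<inter> ?F"
    by (auto simp: less_Suc_eq)
  then have "measure_pmf.prob (G n) {X. \<forall>j<Suc J. \<not> copy_at l w X (position l w t j)} =
      measure_pmf.prob (G n) ?E * measure_pmf.prob (G n) ?F"
    using Pi_pmf_prob_Int[of "vertex_pairs n" ?A ?E ?F False edge_pmf, OF finite_vertex_pairs _ E_cong F_cong]
    by auto
  also have "\<dots> \<le> (1 - copy_prob w) ^ J * (1 - copy_prob w)"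
    using Suc F measure_nonneg order_trans[OF measure_nonneg F] by (intro mult_mono zero_le_power) auto
  finally show ?case by (simp add: mult.commute)
qed simp

text \<open>
  The verdict on \<open>\<psi>\<close> that can be read off from the two end parts alone. The existential quantifiers
  spare a canonical choice of copies: as long as no long edge interferes, all choices agree.
\<close>

definition verdict :: "fm \<Rightarrow> nat \<Rightarrow> ograph \<Rightarrow> nat \<Rightarrow> nat \<Rightarrow> (nat \<times> nat \<Rightarrow> bool) \<Rightarrow> bool" where
  "verdict \<psi> l w J n X \<longleftrightarrow> (\<exists>i<J. \<exists>j<J.
     let u = position l w 0 i; v = position l w (n - J * (2 * l + fst w)) j in
     copy_at l w X u \<and> copy_at l w X v \<and>
     true_in \<psi> (seg X 0 u \<oplus> (w \<oplus> seg X (v + fst w) n)))"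

text \<open>
  Removing vertices from the middle and closing the gap preserves all distances within each of the two
  end parts, hence their joint distribution.
\<close>

lemma prob_verdict:
  assumes N: "N = J * (2 * l + fst w)" and n: "2 * N \<le> n"
  shows "measure_pmf.prob (G n) {X. verdict \<psi> l w J n X} =
    measure_pmf.prob (G (2 * N)) {X. verdict \<psi> l w J (2 * N) X}"
proof -
  define S where "S = {(a, b)\<in>vertex_pairs (2 * N). b \<le> N \<or> N < a}"
  have *: "measure_pmf.prob (G n) {X. verdict \<psi> l w J n X} =
    measure_pmf.prob (Pi_pmf S False edge_pmf) {X. verdict \<psi> l w J (2 * N) X}" if n: "2 * N \<le> n" for n
  proof -
    define s where "s = n - 2 * N"
    define \<phi> where "\<phi> = (\<lambda>(a, b). if b \<le> N then (a, b) else (a + s, b + s :: nat))"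
    define pull where "pull X e \<longleftrightarrow> (if e \<in> S then X (\<phi> e) else False)" for X :: "nat \<times> nat \<Rightarrow> bool" and e
    have left: "pull X (a, b) = X (a, b)" if "0 < a" "a < b" "b \<le> N" for X a b
      using that by (auto simp: pull_def S_def vertex_pairs_def \<phi>_def)
    have right: "pull X (a, b) = X (a + s, b + s)" if "N < a" "a < b" "b \<le> 2 * N" for X a b
      using that by (auto simp: pull_def S_def vertex_pairs_def \<phi>_def)
    have ends: "n - J * (2 * l + fst w) = N + s" "2 * N - J * (2 * l + fst w) = N"
      "n = 2 * N + s"
      using n by (simp_all add: s_def N[symmetric])
    have "verdict \<psi> l w J (2 * N) (pull X) \<longleftrightarrow> verdict \<psi> l w J n X" for X
    proof -
      have L: "copy_at l w (pull X) (position l w 0 i) = copy_at l w X (position l w 0 i)"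
        "seg (pull X) 0 (position l w 0 i) = seg X 0 (position l w 0 i)" if i: "i < J" for i
      proof -
        have pos: "l \<le> position l w 0 i" "position l w 0 i + fst w + l \<le> N"
          using position_less[OF i, of l w 0] by (simp_all add: N position_def)
        show "copy_at l w (pull X) (position l w 0 i) = copy_at l w X (position l w 0 i)"
          using copy_at_shift[of l "position l w 0 i" w "pull X" X 0] pos left by simp
        show "seg (pull X) 0 (position l w 0 i) = seg X 0 (position l w 0 i)"
          using seg_shift[of 0 "position l w 0 i" "pull X" X 0] pos left by simp
      qed
      have R: "copy_at l w (pull X) (position l w N j) = copy_at l w X (position l w (N + s) j)"
        "seg (pull X) (position l w N j + fst w) (2 * N) = seg X (position l w (N + s) j + fst w) n"
        if j: "j < J" for j
      proof -
        have pos: "N + l \<le> position l w N j" "position l w N j + fst w + l \<le> 2 * N"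
          using position_less[OF j, of l w N] by (simp_all add: N position_def)
        have shift: "position l w (N + s) j = position l w N j + s" by (simp add: position_def)
        show "copy_at l w (pull X) (position l w N j) = copy_at l w X (position l w (N + s) j)"
          unfolding shift by (rule copy_at_shift) (use pos right in auto)
        show "seg (pull X) (position l w N j + fst w) (2 * N) = seg X (position l w (N + s) j + fst w) n"
          using seg_shift[of "position l w N j + fst w" "2 * N" "pull X" X s] pos right ends(3)
          by (simp add: shift add_ac)
      qed
      show ?thesis unfolding verdict_def Let_def ends(1,2) by (simp add: L R cong: conj_cong)
    qed
    then have "measure_pmf.prob (G n) {X. verdict \<psi> l w J n X} =
        measure_pmf.prob (map_pmf pull (G n)) {X. verdict \<psi> l w J (2 * N) X}" by simp
    also have "map_pmf pull (G n) = Pi_pmf S False edge_pmf"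
      unfolding pull_def
    proof (rule Pi_pmf_reindex)
      show "finite S" using finite_vertex_pairs by (rule rev_finite_subset) (auto simp: S_def)
      show "inj_on \<phi> S" by (auto simp: inj_on_def \<phi>_def S_def vertex_pairs_def split: if_splits)
      show "\<phi> ` S \<subseteq> vertex_pairs n" using n by (auto simp: \<phi>_def S_def vertex_pairs_def s_def)
    qed (auto simp: \<phi>_def finite_vertex_pairs split: if_splits)
    finally show ?thesis .
  qed
  show ?thesis using *[OF n] *[of "2 * N"] by simp
qed

lemma G_support:
  assumes "X \<in> set_pmf (G n)" "X (a, b)"
  shows "(a, b) \<in> vertex_pairs n" "0 < p (b - a)"
proof -
  have X: "X \<in> PiE_dflt (vertex_pairs n) False (set_pmf \<circ> edge_pmf)"
    using assms(1) by (simp only: set_Pi_pmf[OF finite_vertex_pairs])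
  show ab: "(a, b) \<in> vertex_pairs n"
    using X assms(2) by (auto simp: PiE_dflt_def)
  then have "True \<in> set_pmf (bernoulli_pmf (p (b - a)))"
    using X assms(2) by (force simp: PiE_dflt_def)
  then have "p (b - a) \<noteq> 0" by (auto simp: set_pmf_iff)
  moreover have "0 \<le> p (b - a)" using p_bounds[of "b - a"] ab by (simp add: vertex_pairs_def Suc_le_eq)
  ultimately show "0 < p (b - a)" by simp
qed

lemma Prob_eq_true_in:
  assumes "sentence \<psi>"
  shows "Prob n p \<psi> = measure_pmf.prob (G n) {X. true_in \<psi> (seg X 0 n)}"
proof -
  have "Prob n p \<psi> = measure_pmf.prob (G n) {X. models {1..n} (\<lambda>v w. X (v, w) \<or> X (w, v)) (\<le>) \<psi>}"
    by (simp add: Prob_def random_graph_def)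
  also have "\<dots> = measure_pmf.prob (G n) ({X. models {1..n} (\<lambda>v w. X (v, w) \<or> X (w, v)) (\<le>) \<psi>} \<inter> set_pmf (G n))"
    by (simp only: measure_Int_set_pmf)
  also have "{X. models {1..n} (\<lambda>v w. X (v, w) \<or> X (w, v)) (\<le>) \<psi>} \<inter> set_pmf (G n) =
      {X. true_in \<psi> (seg X 0 n)} \<inter> set_pmf (G n)"
  proof -
    have "models {1..n} (\<lambda>v w. X (v, w) \<or> X (w, v)) (\<le>) \<psi> \<longleftrightarrow> true_in \<psi> (seg X 0 n)"
      if "X \<in> set_pmf (G n)" for X
    proof (rule models_iff_true_in_seg[OF assms])
      show "a < b" if "X (a, b)" for a b
        using G_support(1)[OF \<open>X \<in> set_pmf (G n)\<close> that] by (simp add: vertex_pairs_def)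
    qed
    then show ?thesis by blast
  qed
  finally show ?thesis by (simp only: measure_Int_set_pmf)
qed

text \<open>
  The verdict can err only if the windows at one of the ends contain no copy or if a long edge crosses
  one of the \<open>4 * J\<close> borders.
\<close>

lemma Prob_near_verdict:
  assumes \<psi>: "sentence \<psi>" "qr \<psi> \<le> k"
    and w: "w \<in> admissible p" "\<And>x. x \<in> admissible p \<Longrightarrow> eqv k (w \<oplus> (x \<oplus> w)) w"
    and n: "2 * (J * (2 * l + fst w)) \<le> n"
    and tail: "\<And>n. (\<Sum>d\<in>{l<..n}. real d * p d) \<le> \<delta>"
  shows "\<bar>Prob n p \<psi> - measure_pmf.prob (G n) {X. verdict \<psi> l w J n X}\<bar>
    \<le> 2 * (1 - copy_prob w) ^ J + 4 * real J * \<delta>"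
proof -
  define N where "N = J * (2 * l + fst w)"
  define u v where "u = position l w 0" and "v = position l w (n - N)"
  define none where "none = {X. \<forall>j<J. \<not> copy_at l w X (position l w 0 j)} \<union>
    {X. \<forall>j<J. \<not> copy_at l w X (position l w (n - N) j)}"
  define long where "long j = ({X. long_edge l n X (u j)} \<union> {X. long_edge l n X (u j + fst w)}) \<union>
    ({X. long_edge l n X (v j)} \<union> {X. long_edge l n X (v j + fst w)})" for j
  define bad where "bad = none \<union> (\<Union>j<J. long j)"
  have n: "2 * N \<le> n" using n by (simp add: N_def)
  have Un: "measure_pmf.prob (G n) (A \<union> B) \<le> a + b"
    if "measure_pmf.prob (G n) A \<le> a" "measure_pmf.prob (G n) B \<le> b" for A B a b
    using measure_Un_le[of A "measure_pmf (G n)" B] that by simp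
  have "measure_pmf.prob (G n) none \<le> (1 - copy_prob w) ^ J + (1 - copy_prob w) ^ J"
    unfolding none_def by (intro Un prob_no_copy) (use n in \<open>simp_all add: N_def\<close>)
  moreover have "measure_pmf.prob (G n) (\<Union>j<J. long j) \<le> real J * (4 * \<delta>)"
  proof -
    have edge: "measure_pmf.prob (G n) {X. long_edge l n X c} \<le> \<delta>" for c
      using prob_long_edge tail order_trans by blast
    have "measure_pmf.prob (G n) (long j) \<le> (\<delta> + \<delta>) + (\<delta> + \<delta>)" for j
      unfolding long_def by (intro Un edge)
    then have "(\<Sum>j<J. measure_pmf.prob (G n) (long j)) \<le> (\<Sum>j<J. 4 * \<delta>)"
      by (intro sum_mono) simp
    moreover have "measure_pmf.prob (G n) (\<Union>j<J. long j) \<le> (\<Sum>j<J. measure_pmf.prob (G n) (long j))"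
      by (rule measure_pmf.finite_measure_subadditive_finite) auto
    ultimately show ?thesis by simp
  qed
  ultimately have bad: "measure_pmf.prob (G n) bad \<le> 2 * (1 - copy_prob w) ^ J + 4 * real J * \<delta>"
    unfolding bad_def using Un by fastforce
  have "true_in \<psi> (seg X 0 n) \<longleftrightarrow> verdict \<psi> l w J n X" if X: "X \<in> set_pmf (G n)" "X \<notin> bad" for X
  proof -
    have outer: "true_in \<psi> (seg X 0 n) \<longleftrightarrow> true_in \<psi> (seg X 0 (u i) \<oplus> (w \<oplus> seg X (v j + fst w) n))"
      if ij: "i < J" "j < J" "copy_at l w X (u i)" "copy_at l w X (v j)" for i j
    proof (rule true_in_eqv[OF eqv_outer_parts \<psi>(2,1)])
      show "0 < p (b - a)" if "X (a, b)" for a b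
        using G_support(2)[OF X(1) that] .
      have "u i + fst w \<le> N" using position_less[OF ij(1), of l w 0] by (simp add: u_def N_def)
      moreover have "N \<le> v j" using n by (simp add: v_def position_def)
      ultimately show "u i + fst w \<le> v j" by simp
      show "v j + fst w \<le> n"
        using position_less[OF ij(2), of l w "n - N"] n by (simp add: v_def N_def)
      show "\<not> long_edge l n X (u i)" "\<not> long_edge l n X (u i + fst w)"
        "\<not> long_edge l n X (v j)" "\<not> long_edge l n X (v j + fst w)"
        using X(2) ij(1,2) unfolding bad_def long_def by blast+
    qed (use w ij in auto)
    have "X \<notin> none" using X(2) by (simp add: bad_def)
    then obtain i j where "i < J" "j < J" "copy_at l w X (u i)" "copy_at l w X (v j)"
      by (auto simp: none_def u_def v_def)
    then show ?thesis
      unfolding verdict_def Let_def N_def[symmetric] u_def[symmetric] v_def[symmetric]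
      using outer by blast
  qed
  then have "\<bar>measure_pmf.prob (G n) {X. true_in \<psi> (seg X 0 n)} -
      measure_pmf.prob (G n) {X. verdict \<psi> l w J n X}\<bar> \<le> measure_pmf.prob (G n) bad"
    by (intro prob_diff_le) auto
  then show ?thesis using bad by (simp add: Prob_eq_true_in[OF \<psi>(1)])
qed

lemma Prob_convergent:
  assumes "sentence \<psi>"
  shows "convergent (\<lambda>n. Prob n p \<psi>)"
proof -
  define k where "k = qr \<psi>"
  have "oempty \<in> admissible p" by (simp add: oempty_def admissible_def)
  then obtain w where w: "w \<in> admissible p" "\<And>x. x \<in> admissible p \<Longrightarrow> eqv k (w \<oplus> (x \<oplus> w)) w"
    using exists_absorbing_ograph[of oempty "admissible p" k] admissible_osum by blast
  have "\<exists>M q. \<forall>n\<ge>M. \<bar>Prob n p \<psi> - q\<bar> < e" if e: "0 < e" for e :: real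
  proof -
    have "1 - copy_prob w < 1" using copy_prob_pos[OF w(1)] by simp
    then obtain J where J: "(1 - copy_prob w) ^ J < e / 4"
      using real_arch_pow_inv[of "e / 4" "1 - copy_prob w"] e by auto
    \<comment> \<open>the margin is chosen after \<open>J\<close>: there are \<open>4 * J\<close> borders that a long edge might cross\<close>
    obtain l where l: "\<And>n. (\<Sum>d\<in>{l<..n}. real d * p d) < e / (8 * real (Suc J))"
      using small_tails[of "e / (8 * real (Suc J))"] e by auto
    define N where "N = J * (2 * l + fst w)"
    have "4 * real J * (e / (8 * real (Suc J))) \<le> e / 2" using e by (simp add: field_simps)
    then have "\<bar>Prob n p \<psi> - measure_pmf.prob (G (2 * N)) {X. verdict \<psi> l w J (2 * N) X}\<bar> < e"
      if "2 * N \<le> n" for n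
      using Prob_near_verdict[OF assms order_refl w[unfolded k_def], of J l n "e / (8 * real (Suc J))"]
        prob_verdict[OF N_def that] that J l by (force simp: N_def less_imp_le)
    then show ?thesis by blast
  qed
  note near = this
  have "Cauchy (\<lambda>n. Prob n p \<psi>)"
  proof (rule CauchyI)
    fix e :: real assume "0 < e"
    then obtain M q where Mq: "\<And>n. M \<le> n \<Longrightarrow> \<bar>Prob n p \<psi> - q\<bar> < e / 2"
      using near[of "e / 2"] by auto
    have "norm (Prob m p \<psi> - Prob n p \<psi>) < e" if "M \<le> m" "M \<le> n" for m n
      using Mq[OF that(1)] Mq[OF that(2)] unfolding real_norm_def by linarith
    then show "\<exists>M. \<forall>m\<ge>M. \<forall>n\<ge>M. norm (Prob m p \<psi> - Prob n p \<psi>) < e" by blast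
  qed
  then show ?thesis by (rule Cauchy_convergent)
qed

end

theorem theorem5:
  fixes p :: "nat \<Rightarrow> real" and P :: real and \<psi> :: fm
  assumes "\<And>i. i \<ge> 1 \<Longrightarrow> 0 \<le> p i \<and> p i \<le> 1"
    and "(\<lambda>i. (1 - p (Suc i)) ^ Suc i) has_prod P"
    and "P > 0"
    and "sentence \<psi>"
  shows "convergent (\<lambda>n. Prob n p \<psi>)"
proof -
  define Q where "Q n = (\<Prod>d<n. (1 - p (Suc d)) ^ Suc d)" for n
  have factor: "0 \<le> (1 - p (Suc d)) ^ Suc d" "(1 - p (Suc d)) ^ Suc d \<le> 1" for d
    using assms(1)[of "Suc d"] by (auto intro!: power_le_one simp del: power_Suc)
  have "Q \<longlonglongrightarrow> P" unfolding Q_def by (rule has_prod_imp_tendsto'[OF assms(2)])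
  moreover have "decseq Q"
    using factor by (auto intro!: decseq_SucI mult_left_le prod_nonneg simp: Q_def simp del: power_Suc)
  ultimately have "P \<le> Q n" for n using decseq_ge by blast
  moreover have "Q n = (\<Prod>d=1..n. (1 - p d) ^ d)" for n
    unfolding Q_def by (rule prod.reindex_bij_witness[of _ "\<lambda>d. d - 1" Suc]) auto
  ultimately interpret rapid_decay p P
    by unfold_locales (use assms(1,3) in auto)
  show ?thesis by (rule Prob_convergent[OF assms(4)])
qed

end
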